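(* Suppose \(M\) and \(N\) are transitive models of \(\mathrm{ZF}+\mathrm{DC}\) of ordinal height \(\Omega\), where \(\mathrm{cf}(\Omega)\neq\omega\) (here \(M,N\) may be proper classes, in which case \(\Omega=\mathrm{Ord}\)). Suppose \(j:M\to N\) is an elementary embedding definable over \(M\) from parameters in \(M\), and \(i:M\to N\) is an arbitrary elementary embedding. Then for every ordinal \(\alpha<\Omega\), \(j(\alpha)\leq i(\alpha)\). *)

theory Defs
  imports Main
begin

text \<open>
  The universe of sets is a type \<open>'v\<close> with a membership relation that is extensional and
  well-founded; no closure properties of the universe are required.  Classes are arbitrary
  HOL sets of type \<open>'v set\<close>, and a set is identified with the class of its elements.  Thus a
  transitive class \<open>M :: 'v set\<close> may be the extension of a set or a proper class.  By the
  Mostowski collapse, every pair of transitive sets occurs in this way; if the universe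
  itself satisfies ZF then \<open>M\<close> may be one of its proper class inner models.
\<close>

definition set_universe :: "('v \<Rightarrow> 'v \<Rightarrow> bool) \<Rightarrow> bool" where
  "set_universe E \<longleftrightarrow> wfp E \<and> (\<forall>x y. (\<forall>z. E z x \<longleftrightarrow> E z y) \<longrightarrow> x = y)"

definition transitive_class :: "('v \<Rightarrow> 'v \<Rightarrow> bool) \<Rightarrow> 'v set \<Rightarrow> bool" where
  "transitive_class E M \<longleftrightarrow> (\<forall>x\<in>M. \<forall>y. E y x \<longrightarrow> y \<in> M)"

text \<open>First-order formulas in the language of set theory, with variables named by naturals.\<close>

datatype fm =
    Member nat nat
  | Equal nat nat
  | Neg fm
  | Conj fm fm
  | Exists nat fm

text \<open>
  Below, \<open>D\<close> is the domain of a structure \<open>(D, \<epsilon>)\<close>; all quantifiers in the axioms are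
  relativized to \<open>D\<close>.
\<close>

context
  fixes E :: "'v \<Rightarrow> 'v \<Rightarrow> bool"  (infix "\<epsilon>" 50)
    and D :: "'v set"
begin

primrec sat :: "(nat \<Rightarrow> 'v) \<Rightarrow> fm \<Rightarrow> bool" where
  "sat s (Member m n) \<longleftrightarrow> s m \<epsilon> s n"
| "sat s (Equal m n) \<longleftrightarrow> s m = s n"
| "sat s (Neg p) \<longleftrightarrow> \<not> sat s p"
| "sat s (Conj p q) \<longleftrightarrow> sat s p \<and> sat s q"
| "sat s (Exists n p) \<longleftrightarrow> (\<exists>x\<in>D. sat (s(n := x)) p)"

definition is_subset :: "'v \<Rightarrow> 'v \<Rightarrow> bool" where
  "is_subset x y \<longleftrightarrow> (\<forall>z\<in>D. z \<epsilon> x \<longrightarrow> z \<epsilon> y)"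

definition is_empty :: "'v \<Rightarrow> bool" where
  "is_empty x \<longleftrightarrow> (\<forall>z\<in>D. \<not> z \<epsilon> x)"

definition is_upair :: "'v \<Rightarrow> 'v \<Rightarrow> 'v \<Rightarrow> bool" where
  "is_upair a b p \<longleftrightarrow> (\<forall>z\<in>D. z \<epsilon> p \<longleftrightarrow> z = a \<or> z = b)"

definition is_opair :: "'v \<Rightarrow> 'v \<Rightarrow> 'v \<Rightarrow> bool" where
  "is_opair a b p \<longleftrightarrow> (\<exists>u\<in>D. \<exists>v\<in>D. is_upair a a u \<and> is_upair a b v \<and> is_upair u v p)"

definition opair_in :: "'v \<Rightarrow> 'v \<Rightarrow> 'v \<Rightarrow> bool" where
  "opair_in a b r \<longleftrightarrow> (\<exists>p\<in>D. is_opair a b p \<and> p \<epsilon> r)"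

definition is_function :: "'v \<Rightarrow> 'v \<Rightarrow> 'v \<Rightarrow> bool" where
  "is_function f A B \<longleftrightarrow>
     (\<forall>p\<in>D. p \<epsilon> f \<longrightarrow> (\<exists>x\<in>D. \<exists>y\<in>D. x \<epsilon> A \<and> y \<epsilon> B \<and> is_opair x y p)) \<and>
     (\<forall>x\<in>D. x \<epsilon> A \<longrightarrow> (\<exists>!y. y \<in> D \<and> opair_in x y f))"

definition is_succ :: "'v \<Rightarrow> 'v \<Rightarrow> bool" where
  "is_succ x y \<longleftrightarrow> (\<forall>z\<in>D. z \<epsilon> y \<longleftrightarrow> z \<epsilon> x \<or> z = x)"

definition is_inductive :: "'v \<Rightarrow> bool" where
  "is_inductive w \<longleftrightarrow>
     (\<exists>z\<in>D. is_empty z \<and> z \<epsilon> w) \<and>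
     (\<forall>x\<in>D. x \<epsilon> w \<longrightarrow> (\<exists>y\<in>D. is_succ x y \<and> y \<epsilon> w))"

definition is_omega :: "'v \<Rightarrow> bool" where
  "is_omega w \<longleftrightarrow> is_inductive w \<and> (\<forall>v\<in>D. is_inductive v \<longrightarrow> is_subset w v)"

definition Extensionality_ax :: bool where
  "Extensionality_ax \<longleftrightarrow> (\<forall>x\<in>D. \<forall>y\<in>D. (\<forall>z\<in>D. z \<epsilon> x \<longleftrightarrow> z \<epsilon> y) \<longrightarrow> x = y)"

definition Foundation_ax :: bool where
  "Foundation_ax \<longleftrightarrow>
     (\<forall>x\<in>D. (\<exists>y\<in>D. y \<epsilon> x) \<longrightarrow> (\<exists>y\<in>D. y \<epsilon> x \<and> \<not> (\<exists>z\<in>D. z \<epsilon> x \<and> z \<epsilon> y)))"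

definition Pairing_ax :: bool where
  "Pairing_ax \<longleftrightarrow> (\<forall>a\<in>D. \<forall>b\<in>D. \<exists>p\<in>D. is_upair a b p)"

definition Union_ax :: bool where
  "Union_ax \<longleftrightarrow> (\<forall>x\<in>D. \<exists>u\<in>D. \<forall>z\<in>D. z \<epsilon> u \<longleftrightarrow> (\<exists>y\<in>D. y \<epsilon> x \<and> z \<epsilon> y))"

definition Powerset_ax :: bool where
  "Powerset_ax \<longleftrightarrow> (\<forall>x\<in>D. \<exists>p\<in>D. \<forall>z\<in>D. z \<epsilon> p \<longleftrightarrow> is_subset z x)"

definition Infinity_ax :: bool where
  "Infinity_ax \<longleftrightarrow> (\<exists>w\<in>D. is_inductive w)"

text \<open>
  In the two schemata the assignment \<open>s\<close> supplies the parameters; the bound variables are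
  \<open>0\<close> and \<open>1\<close>.
\<close>

definition Separation_schema :: bool where
  "Separation_schema \<longleftrightarrow>
     (\<forall>p s. range s \<subseteq> D \<longrightarrow>
       (\<forall>A\<in>D. \<exists>B\<in>D. \<forall>x\<in>D. x \<epsilon> B \<longleftrightarrow> x \<epsilon> A \<and> sat (s(0 := x)) p))"

definition Replacement_schema :: bool where
  "Replacement_schema \<longleftrightarrow>
     (\<forall>p s. range s \<subseteq> D \<longrightarrow>
       (\<forall>A\<in>D. (\<forall>x\<in>D. x \<epsilon> A \<longrightarrow> (\<exists>!y. y \<in> D \<and> sat (s(0 := x, 1 := y)) p)) \<longrightarrow>
         (\<exists>B\<in>D. \<forall>y\<in>D. y \<epsilon> B \<longleftrightarrow> (\<exists>x\<in>D. x \<epsilon> A \<and> sat (s(0 := x, 1 := y)) p))))"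

definition models_ZF :: bool where
  "models_ZF \<longleftrightarrow>
     Extensionality_ax \<and> Foundation_ax \<and> Pairing_ax \<and> Union_ax \<and> Powerset_ax \<and>
     Infinity_ax \<and> Separation_schema \<and> Replacement_schema"

text \<open>
  Dependent choice: if \<open>R\<close> is a relation such that every element of the nonempty set \<open>A\<close> has
  an \<open>R\<close>-successor in \<open>A\<close>, then there is \<open>f : \<omega> \<rightarrow> A\<close> with \<open>f(n) R f(n+1)\<close> for all \<open>n\<close>.
\<close>

definition models_DC :: bool where
  "models_DC \<longleftrightarrow>
     (\<forall>A\<in>D. \<forall>R\<in>D.
        \<not> is_empty A \<and> (\<forall>x\<in>D. x \<epsilon> A \<longrightarrow> (\<exists>y\<in>D. y \<epsilon> A \<and> opair_in x y R)) \<longrightarrow>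
        (\<exists>w\<in>D. \<exists>f\<in>D. is_omega w \<and> is_function f w A \<and>
           (\<forall>n\<in>D. \<forall>m\<in>D. n \<epsilon> w \<and> is_succ n m \<longrightarrow>
              (\<exists>x\<in>D. \<exists>y\<in>D. opair_in n x f \<and> opair_in m y f \<and> opair_in x y R))))"

definition definable_relation :: "('v \<times> 'v) set \<Rightarrow> bool" where
  "definable_relation R \<longleftrightarrow>
     (\<exists>p s. range s \<subseteq> D \<and> R = {(x, y). x \<in> D \<and> y \<in> D \<and> sat (s(0 := x, 1 := y)) p})"

end

text \<open>
  Maps between classes are total HOL functions of which only the values on the domain \<open>M\<close>
  matter.  Definability of \<open>j\<close> over \<open>M\<close> entails that \<open>j\<close> takes values in \<open>M\<close>.
\<close>

definition elementary_embedding ::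
    "('v \<Rightarrow> 'v \<Rightarrow> bool) \<Rightarrow> 'v set \<Rightarrow> 'v set \<Rightarrow> ('v \<Rightarrow> 'v) \<Rightarrow> bool" where
  "elementary_embedding E M N j \<longleftrightarrow>
     j ` M \<subseteq> N \<and> (\<forall>p s. range s \<subseteq> M \<longrightarrow> (sat E M s p \<longleftrightarrow> sat E N (j \<circ> s) p))"

definition definable_map :: "('v \<Rightarrow> 'v \<Rightarrow> bool) \<Rightarrow> 'v set \<Rightarrow> ('v \<Rightarrow> 'v) \<Rightarrow> bool" where
  "definable_map E M j \<longleftrightarrow> definable_relation E M {(x, j x) | x. x \<in> M}"

text \<open>
  Von Neumann ordinals; as the universe is well-founded, a transitive set totally ordered by
  membership is well-ordered by it.
\<close>

definition ordinal :: "('v \<Rightarrow> 'v \<Rightarrow> bool) \<Rightarrow> 'v \<Rightarrow> bool" where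
  "ordinal E x \<longleftrightarrow>
     (\<forall>y z. E y x \<and> E z y \<longrightarrow> E z x) \<and>
     (\<forall>y z. E y x \<and> E z x \<longrightarrow> E y z \<or> y = z \<or> E z y)"

definition ord_le :: "('v \<Rightarrow> 'v \<Rightarrow> bool) \<Rightarrow> 'v \<Rightarrow> 'v \<Rightarrow> bool" where
  "ord_le E x y \<longleftrightarrow> E x y \<or> x = y"

text \<open>
  The height of \<open>M\<close> is the class of its ordinals.  For transitive \<open>M\<close> this is an initial
  segment of the ordinals: the elements of the von Neumann ordinal \<open>\<Omega>\<close> if it exists in the
  universe, and otherwise the class of all ordinals.
\<close>

definition ordinal_height :: "('v \<Rightarrow> 'v \<Rightarrow> bool) \<Rightarrow> 'v set \<Rightarrow> 'v set" where
  "ordinal_height E M = {x \<in> M. ordinal E x}"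

definition ord_order :: "('v \<Rightarrow> 'v \<Rightarrow> bool) \<Rightarrow> 'v set \<Rightarrow> 'v rel" where
  "ord_order E \<Omega> = {(x, y). x \<in> \<Omega> \<and> y \<in> \<Omega> \<and> ord_le E x y}"

definition cofinal_map :: "'b rel \<Rightarrow> 'a rel \<Rightarrow> ('b \<Rightarrow> 'a) \<Rightarrow> bool" where
  "cofinal_map s r f \<longleftrightarrow>
     f ` Field s \<subseteq> Field r \<and> (\<forall>a\<in>Field r. \<exists>b\<in>Field s. (a, f b) \<in> r)"

text \<open>
  \<open>s\<close> has the least order type of a well-order admitting a cofinal map into \<open>r\<close>.  It suffices
  to compare with well-orders on the type of \<open>s\<close>, since these realize every order type below
  that of \<open>s\<close>.
\<close>

definition has_cofinality :: "'a rel \<Rightarrow> 'b rel \<Rightarrow> bool" where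
  "has_cofinality r s \<longleftrightarrow>
     Well_order s \<and> (\<exists>f. cofinal_map s r f) \<and>
     (\<forall>s' :: 'b rel. Well_order s' \<and> (\<exists>f. cofinal_map s' r f) \<longrightarrow> (s, s') \<in> ordLeq)"

end

theory Submission
  imports Defs
begin

text \<open>
  Code the parameters of \<open>j\<close> by a single set \<open>c\<close> and suppose \<open>i \<alpha> < j \<alpha>\<close>.  As \<open>N\<close> is the union of
  the sets \<open>j x\<close>, it is definable over \<open>M\<close> from \<open>c\<close>, so \<open>i\<close> copies \<open>(M, N, j)\<close> to a sequence of
  models \<open>N\<^sub>0 = M\<close>, \<open>N\<^sub>1 = N\<close>, \<open>\<dots>\<close> with elementary \<open>j\<^sub>n : N\<^sub>n \<rightarrow> N\<^sub>n\<^sub>+\<^sub>1\<close> defined over \<open>N\<^sub>n\<close>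
  from \<open>c\<^sub>n = i\<^sup>n c\<close>, and the ordinals \<open>\<alpha>\<^sub>n = i\<^sup>n \<alpha>\<close> satisfy \<open>\<alpha>\<^sub>n\<^sub>+\<^sub>1 < j\<^sub>n \<alpha>\<^sub>n\<close>.  Since the
  cofinality of \<open>\<Omega>\<close> is not \<open>\<omega>\<close>, some level \<open>Q\<close> of the cumulative hierarchy of \<open>M\<close> contains
  every \<open>c\<^sub>n\<close>.

  In \<open>M\<close>, recursion on ordinals gives a function \<open>r\<close> with \<open>r(\<beta>) = \<Union>q\<in>Q. ran (j\<^sub>q (r|\<beta>))\<close>, where
  \<open>j\<^sub>q\<close> is defined from \<open>q\<close> as \<open>j\<close> is from \<open>c\<close>.  With \<open>r\<^sub>0 = r\<close> and \<open>r\<^sub>n\<^sub>+\<^sub>1 = j\<^sub>n r\<^sub>n\<close>, the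
  recursion for \<open>r\<^sub>n\<close> in \<open>N\<^sub>n\<close> yields \<open>r\<^sub>n\<^sub>+\<^sub>1(\<alpha>\<^sub>n\<^sub>+\<^sub>1) \<in> r\<^sub>n(\<alpha>\<^sub>n)\<close> for all \<open>n\<close>, contradicting
  well-foundedness.  Here \<open>r\<^sub>n(\<alpha>\<^sub>n)\<close> plays the role of the Mostowski collapse of the direct limit.
\<close>

section \<open>Formulas: relevant variables, renaming and blocks of quantifiers\<close>

text \<open>Any \<open>k\<close> above the indices occurring in \<open>p\<close> works. As it
  depends on \<open>p\<close> and not on \<open>D\<close>, one choice of fresh variable serves all
  structures at once.\<close>

lemma sat_finite_support:
  fixes E :: "'a \<Rightarrow> 'a \<Rightarrow> bool"
  shows "\<exists>k. \<forall>D s s'. (\<forall>n<k. s n = s' n) \<longrightarrow> sat E D s p = sat E D s' p"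
proof (induction p)
  case (Member m n)
  show ?case by (rule exI[of _ "Suc (max m n)"]) (auto simp: less_Suc_eq_le)
next
  case (Equal m n)
  show ?case by (rule exI[of _ "Suc (max m n)"]) (auto simp: less_Suc_eq_le)
next
  case (Neg p)
  then show ?case by (metis sat.simps(3))
next
  case (Conj p q)
  then obtain k l where
    k: "\<forall>D s s'. (\<forall>n<k. s n = s' n) \<longrightarrow> sat E D s p = sat E D s' p" and
    l: "\<forall>D s s'. (\<forall>n<l. s n = s' n) \<longrightarrow> sat E D s q = sat E D s' q" by auto
  show ?case
  proof (intro exI[of _ "max k l"] allI impI)
    fix D and s s' :: "nat \<Rightarrow> 'a" assume "\<forall>n<max k l. s n = s' n"
    then have "sat E D s p = sat E D s' p" "sat E D s q = sat E D s' q"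
      using k l by (metis less_max_iff_disj)+
    then show "sat E D s (Conj p q) = sat E D s' (Conj p q)" by simp
  qed
next
  case (Exists n p)
  then obtain k where
    k: "\<And>D s s'. (\<forall>n<k. s n = s' n) \<Longrightarrow> sat E D s p = sat E D s' p" by auto
  show ?case
  proof (intro exI[of _ k] allI impI)
    fix D and s s' :: "nat \<Rightarrow> 'a" assume "\<forall>n<k. s n = s' n"
    then have "sat E D (s(n := x)) p = sat E D (s'(n := x)) p" for x by (intro k) auto
    then show "sat E D s (Exists n p) = sat E D s' (Exists n p)" by simp
  qed
qed

text \<open>\<open>f\<close> need not be injective, so variables may be identified as well as
  permuted. The bound variable of a quantifier moves to a fresh index to avoid capture.\<close>

lemma sat_rename:
  fixes E :: "'a \<Rightarrow> 'a \<Rightarrow> bool"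
  shows "\<exists>q. \<forall>D s. sat E D s q \<longleftrightarrow> sat E D (\<lambda>n. s (f n)) p"
proof (induction p arbitrary: f)
  case (Member m n)
  show ?case by (rule exI[of _ "Member (f m) (f n)"]) simp
next
  case (Equal m n)
  show ?case by (rule exI[of _ "Equal (f m) (f n)"]) simp
next
  case (Neg p)
  then show ?case by (metis sat.simps(3))
next
  case (Conj p q)
  then show ?case by (metis sat.simps(4))
next
  case (Exists n p)
  obtain k where
    k: "\<And>D s s'. (\<forall>n<k. s n = s' n) \<Longrightarrow> sat E D s p = sat E D s' p"
    using sat_finite_support[of E p] by blast
  \<comment> \<open>Larger than every \<open>f l\<close> with \<open>l < k\<close>, so
    \<open>m\<close> collides with no renamed relevant variable.\<close>
  define m where "m = Suc (\<Sum>l<k. f l)"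
  have m: "f l \<noteq> m" if "l < k" for l
    using member_le_sum[of l "{..<k}" f] that by (auto simp: m_def)
  obtain q where q: "\<And>D s. sat E D s q \<longleftrightarrow> sat E D (\<lambda>l. s ((f(n := m)) l)) p"
    using Exists[of "f(n := m)"] by blast
  show ?case
  proof (intro exI[of _ "Exists m q"] allI)
    fix D and s :: "nat \<Rightarrow> 'a"
    have "sat E D (s(m := x)) q \<longleftrightarrow> sat E D ((\<lambda>l. s (f l))(n := x)) p" for x
      unfolding q by (rule k) (auto simp: m)
    then show "sat E D s (Exists m q) \<longleftrightarrow> sat E D (\<lambda>l. s (f l)) (Exists n p)" by simp
  qed
qed

primrec exists_vars :: "nat list \<Rightarrow> fm \<Rightarrow> fm" where
  "exists_vars [] p = p"
| "exists_vars (n # ns) p = Exists n (exists_vars ns p)"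

lemma sat_exists_vars:
  "range s \<subseteq> D \<Longrightarrow> sat E D s (exists_vars ns p) \<longleftrightarrow>
     (\<exists>s'. range s' \<subseteq> D \<and> (\<forall>n. n \<notin> set ns \<longrightarrow> s' n = s n) \<and> sat E D s' p)"
proof (induction ns arbitrary: s)
  case Nil
  have "s' = s" if "\<forall>n. s' n = s n" for s' using that by auto
  with Nil show ?case by auto
next
  case (Cons n ns)
  have r: "range (s(n := x)) \<subseteq> D" if "x \<in> D" for x using Cons.prems that by auto
  show ?case (is "?L \<longleftrightarrow> ?R")
  proof
    assume ?L
    then obtain x where "x \<in> D" "sat E D (s(n := x)) (exists_vars ns p)" by auto
    then obtain s' where s': "range s' \<subseteq> D" "\<forall>m. m \<notin> set ns \<longrightarrow> s' m = (s(n := x)) m"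
        "sat E D s' p"
      using Cons.IH[OF r] by blast
    have "\<forall>m. m \<notin> set (n # ns) \<longrightarrow> s' m = s m" using s'(2) by simp
    then show ?R using s' by blast
  next
    assume ?R
    then obtain s' where s': "range s' \<subseteq> D" "\<forall>m. m \<notin> set (n # ns) \<longrightarrow> s' m = s m" "sat E D s' p"
      by blast
    have "s' n \<in> D" using s'(1) by auto
    moreover have "\<forall>m. m \<notin> set ns \<longrightarrow> s' m = (s(n := s' n)) m" using s'(2) by simp
    then have "sat E D (s(n := s' n)) (exists_vars ns p)"
      using Cons.IH[OF r[OF \<open>s' n \<in> D\<close>]] s' by blast
    ultimately show ?L by auto
  qed
qed

section \<open>Well-founded extensional membership\<close>

locale set_univ =
  fixes E :: "'v \<Rightarrow> 'v \<Rightarrow> bool"  (infix "\<epsilon>" 50)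
  assumes univ: "set_universe E"
begin

lemma mem_induct: "(\<And>x. (\<And>y. y \<epsilon> x \<Longrightarrow> P y) \<Longrightarrow> P x) \<Longrightarrow> P a"
  using univ unfolding set_universe_def by (metis wfp_induct)

lemma no_descending: "\<not> (\<forall>n::nat. f (Suc n) \<epsilon> f n)"
  using univ unfolding set_universe_def wfp_def wf_iff_no_infinite_down_chain by auto

lemma mem_asym: "x \<epsilon> y \<Longrightarrow> \<not> y \<epsilon> x"
  using univ unfolding set_universe_def by (metis wfp_imp_asymp asympD)

lemma mem_irrefl: "\<not> x \<epsilon> x"
  using mem_asym by blast

lemma no_3_cycle: "x \<epsilon> y \<Longrightarrow> y \<epsilon> z \<Longrightarrow> \<not> z \<epsilon> x"
  by (induction x arbitrary: y z rule: mem_induct) blast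

definition elts :: "'v \<Rightarrow> 'v set" where "elts x = {y. y \<epsilon> x}"

lemma mem_elts [simp]: "y \<in> elts x \<longleftrightarrow> y \<epsilon> x"
  by (simp add: elts_def)

lemma elts_inject: "elts x = elts y \<longleftrightarrow> x = y"
  using univ unfolding set_universe_def set_eq_iff by auto

abbreviation transitive :: "'v set \<Rightarrow> bool" where
  "transitive \<equiv> transitive_class E"

lemma transitiveD: "transitive D \<Longrightarrow> x \<in> D \<Longrightarrow> y \<epsilon> x \<Longrightarrow> y \<in> D"
  by (auto simp: transitive_class_def)

subsection \<open>Uniformly definable predicates\<close>

text \<open>\<open>D\<close> is an argument because one formula is to be evaluated in every model of
  the iteration. Closure rules for such predicates replace writing formulas out.\<close>

definition Dfn :: "('v set \<Rightarrow> (nat \<Rightarrow> 'v) \<Rightarrow> bool) \<Rightarrow> bool" where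
  "Dfn P \<longleftrightarrow> (\<exists>p. \<forall>D s. transitive D \<and> range s \<subseteq> D \<longrightarrow> (P D s \<longleftrightarrow> sat E D s p))"

lemma DfnE:
  assumes "Dfn P"
  obtains p where "\<And>D s. transitive D \<Longrightarrow> range s \<subseteq> D \<Longrightarrow> P D s \<longleftrightarrow> sat E D s p"
  using assms unfolding Dfn_def by auto

lemma Dfn_cong:
  "(\<And>D s. transitive D \<Longrightarrow> range s \<subseteq> D \<Longrightarrow> P D s \<longleftrightarrow> Q D s) \<Longrightarrow> Dfn Q \<Longrightarrow> Dfn P"
  unfolding Dfn_def by blast

lemma Dfn_mem: "Dfn (\<lambda>D s. s a \<epsilon> s b)"
  unfolding Dfn_def by (rule exI[of _ "Member a b"]) simp

lemma Dfn_eq: "Dfn (\<lambda>D s. s a = s b)"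
  unfolding Dfn_def by (rule exI[of _ "Equal a b"]) simp

lemma Dfn_not: "Dfn P \<Longrightarrow> Dfn (\<lambda>D s. \<not> P D s)"
  unfolding Dfn_def by (metis sat.simps(3))

lemma Dfn_conj: "Dfn P \<Longrightarrow> Dfn Q \<Longrightarrow> Dfn (\<lambda>D s. P D s \<and> Q D s)"
  unfolding Dfn_def by (metis sat.simps(4))

lemma Dfn_disj: "Dfn P \<Longrightarrow> Dfn Q \<Longrightarrow> Dfn (\<lambda>D s. P D s \<or> Q D s)"
  using Dfn_not[OF Dfn_conj[OF Dfn_not Dfn_not], of P Q] by simp

lemma Dfn_imp: "Dfn P \<Longrightarrow> Dfn Q \<Longrightarrow> Dfn (\<lambda>D s. P D s \<longrightarrow> Q D s)"
  unfolding imp_conv_disj by (intro Dfn_disj Dfn_not)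

lemma Dfn_iff: "Dfn P \<Longrightarrow> Dfn Q \<Longrightarrow> Dfn (\<lambda>D s. P D s \<longleftrightarrow> Q D s)"
  unfolding iff_conv_conj_imp by (intro Dfn_conj Dfn_imp)

lemma Dfn_rename: assumes "Dfn P" shows "Dfn (\<lambda>D s. P D (\<lambda>n. s (f n)))"
proof -
  obtain p where p: "\<And>D s. transitive D \<Longrightarrow> range s \<subseteq> D \<Longrightarrow> P D s \<longleftrightarrow> sat E D s p"
    by (rule DfnE[OF assms that])
  obtain q where "\<And>D s. sat E D s q \<longleftrightarrow> sat E D (\<lambda>n. s (f n)) p"
    using sat_rename[of E f p] by blast
  then show ?thesis
    unfolding Dfn_def by (intro exI[of _ q]) (auto intro!: p)
qed

text \<open>De Bruijn style: the bound element becomes variable \<open>0\<close> and the others are shifted.\<close>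

lemma Dfn_ex:
  assumes "Dfn (\<lambda>D s. P D (\<lambda>n. s (Suc n)) (s 0))"
  shows "Dfn (\<lambda>D s. \<exists>x\<in>D. P D s x)"
proof -
  obtain p where p: "\<And>D s. transitive D \<Longrightarrow> range s \<subseteq> D \<Longrightarrow>
      P D (\<lambda>n. s (Suc n)) (s 0) \<longleftrightarrow> sat E D s p"
    by (rule DfnE[OF assms that])
  obtain k where
    k: "\<And>D s s'. (\<forall>n<k. s n = s' n) \<Longrightarrow> sat E D s p = sat E D s' p"
    using sat_finite_support[of E p] by blast
  \<comment> \<open>\<open>case_nat k id\<close> undoes the shift: the bound element is read from
    the fresh variable \<open>k\<close>, and every other variable returns to its original
    index.\<close>
  obtain q where q: "\<And>D s. sat E D s q \<longleftrightarrow> sat E D (\<lambda>n. s (case_nat k id n)) p"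
    using sat_rename[of E "case_nat k id" p] by blast
  show ?thesis
    unfolding Dfn_def
  proof (intro exI[of _ "Exists k q"] allI impI)
    fix D and s :: "nat \<Rightarrow> 'v" assume D: "transitive D \<and> range s \<subseteq> D"
    have "P D s x \<longleftrightarrow> sat E D (s(k := x)) q" if "x \<in> D" for x
    proof -
      have "range (case_nat x s) \<subseteq> D" using D that by (auto split: nat.splits simp: image_subset_iff)
      then have "P D s x \<longleftrightarrow> sat E D (case_nat x s) p"
        using p[of D "case_nat x s"] D by simp
      also have "\<dots> \<longleftrightarrow> sat E D (s(k := x)) q"
        unfolding q by (rule k) (auto split: nat.splits)
      finally show ?thesis .
    qed
    then show "(\<exists>x\<in>D. P D s x) \<longleftrightarrow> sat E D s (Exists k q)" by simp
  qed
qed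

lemma Dfn_all:
  assumes "Dfn (\<lambda>D s. P D (\<lambda>n. s (Suc n)) (s 0))"
  shows "Dfn (\<lambda>D s. \<forall>x\<in>D. P D s x)"
  using Dfn_not[OF Dfn_ex[of "\<lambda>D s x. \<not> P D s x"]] Dfn_not[OF assms] by simp

text \<open>By transitivity all elements of \<open>s a\<close> lie in \<open>D\<close>, so bounded
  quantifiers need no mention of \<open>D\<close>. Notions built from them alone are absolute
  between transitive classes.\<close>

lemma Dfn_bex:
  assumes "Dfn (\<lambda>D s. P D (\<lambda>n. s (Suc n)) (s 0))"
  shows "Dfn (\<lambda>D s. \<exists>x\<in>elts (s a). P D s x)"
proof (rule Dfn_cong)
  show "Dfn (\<lambda>D s. \<exists>x\<in>D. x \<epsilon> s a \<and> P D s x)"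
    by (intro Dfn_ex Dfn_conj Dfn_mem assms)
next
  fix D and s :: "nat \<Rightarrow> 'v" assume D: "transitive D" "range s \<subseteq> D"
  then have "x \<in> D" if "x \<epsilon> s a" for x using that transitiveD by blast
  then show "(\<exists>x\<in>elts (s a). P D s x) \<longleftrightarrow> (\<exists>x\<in>D. x \<epsilon> s a \<and> P D s x)" by auto
qed

lemma Dfn_ball:
  assumes "Dfn (\<lambda>D s. P D (\<lambda>n. s (Suc n)) (s 0))"
  shows "Dfn (\<lambda>D s. \<forall>x\<in>elts (s a). P D s x)"
  using Dfn_not[OF Dfn_bex[of "\<lambda>D s x. \<not> P D s x" a]] Dfn_not[OF assms] by simp

text \<open>The quantifier over \<open>l\<close> is outside the object language and unfolds into
  finitely many conjuncts. It serves to say that finitely many pairs belong to the graph of an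
  embedding.\<close>

lemma Dfn_all_less: "(\<And>l. l < (k::nat) \<Longrightarrow> Dfn (P l)) \<Longrightarrow> Dfn (\<lambda>D s. \<forall>l<k. P l D s)"
proof (induction k)
  case 0
  show ?case unfolding Dfn_def by (intro exI[of _ "Equal 0 0"]) simp
next
  case (Suc k)
  then show ?case by (simp add: All_less_Suc) (intro Dfn_conj, auto)
qed

lemmas Dfn_intros =
  Dfn_mem Dfn_eq Dfn_not Dfn_conj Dfn_disj Dfn_imp Dfn_iff Dfn_ex Dfn_all Dfn_bex Dfn_ball

subsection \<open>Ordered pairs and functions\<close>

definition upair :: "'v \<Rightarrow> 'v \<Rightarrow> 'v \<Rightarrow> bool" where
  "upair a b p \<longleftrightarrow> a \<epsilon> p \<and> b \<epsilon> p \<and> (\<forall>z\<in>elts p. z = a \<or> z = b)"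

text \<open>Kuratowski pairs, with the quantifiers bounded by \<open>p\<close> to make the notion
  absolute.\<close>

definition pair :: "'v \<Rightarrow> 'v \<Rightarrow> 'v \<Rightarrow> bool" where
  "pair a b p \<longleftrightarrow> (\<exists>u\<in>elts p. \<exists>v\<in>elts p. upair a a u \<and> upair a b v \<and> upair u v p)"

definition pfst :: "'v \<Rightarrow> 'v \<Rightarrow> bool" where
  "pfst a p \<longleftrightarrow> (\<exists>v\<in>elts p. \<exists>b\<in>elts v. pair a b p)"

definition psnd :: "'v \<Rightarrow> 'v \<Rightarrow> bool" where
  "psnd b p \<longleftrightarrow> (\<exists>v\<in>elts p. \<exists>a\<in>elts v. pair a b p)"

definition fapp :: "'v \<Rightarrow> 'v \<Rightarrow> 'v \<Rightarrow> bool" where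
  "fapp f d z \<longleftrightarrow> (\<exists>p\<in>elts f. pair d z p)"

definition rng :: "'v \<Rightarrow> 'v \<Rightarrow> bool" where
  "rng z f \<longleftrightarrow> (\<exists>p\<in>elts f. psnd z p)"

definition restr :: "'v \<Rightarrow> 'v \<Rightarrow> 'v \<Rightarrow> bool" where
  "restr f d g \<longleftrightarrow> (\<forall>p\<in>elts g. p \<epsilon> f \<and> (\<exists>e\<in>elts d. pfst e p)) \<and>
     (\<forall>p\<in>elts f. (\<exists>e\<in>elts d. pfst e p) \<longrightarrow> p \<epsilon> g)"

lemma Dfn_upair: "Dfn (\<lambda>D s. upair (s a) (s b) (s c))"
  unfolding upair_def by (intro Dfn_intros)

lemma Dfn_pair: "Dfn (\<lambda>D s. pair (s a) (s b) (s c))"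
  unfolding pair_def by (intro Dfn_intros Dfn_upair)

lemma Dfn_pfst: "Dfn (\<lambda>D s. pfst (s a) (s b))"
  unfolding pfst_def by (intro Dfn_intros Dfn_pair)

lemma Dfn_psnd: "Dfn (\<lambda>D s. psnd (s a) (s b))"
  unfolding psnd_def by (intro Dfn_intros Dfn_pair)

lemma Dfn_fapp: "Dfn (\<lambda>D s. fapp (s a) (s b) (s c))"
  unfolding fapp_def by (intro Dfn_intros Dfn_pair)

lemma Dfn_rng: "Dfn (\<lambda>D s. rng (s a) (s b))"
  unfolding rng_def by (intro Dfn_intros Dfn_psnd)

lemma Dfn_restr: "Dfn (\<lambda>D s. restr (s a) (s b) (s c))"
  unfolding restr_def by (intro Dfn_intros Dfn_pfst)

lemma upair_iff: "upair a b p \<longleftrightarrow> elts p = {a, b}"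
  unfolding upair_def elts_def by auto

lemma pair_iff: "pair a b p \<longleftrightarrow> (\<exists>u v. elts u = {a} \<and> elts v = {a, b} \<and> elts p = {u, v})"
  unfolding pair_def upair_iff by blast

lemma pair_unique: "pair a b p \<Longrightarrow> pair a b q \<Longrightarrow> p = q"
  unfolding pair_iff by (metis elts_inject)

lemma pair_inject:
  assumes "pair a b p" "pair c d p" shows "a = c \<and> b = d"
proof -
  have *: "elts ` elts p = {{a}, {a, b}}" if "pair a b p" for a b
    using that unfolding pair_iff by force
  have "{{a}, {a, b}} = {{c}, {c, d}}" using *[OF assms(1)] *[OF assms(2)] by simp
  then show ?thesis by (auto simp: doubleton_eq_iff)
qed

lemma pfst_iff: "pfst a p \<longleftrightarrow> (\<exists>b. pair a b p)"
  unfolding pfst_def pair_iff by blast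

lemma psnd_iff: "psnd b p \<longleftrightarrow> (\<exists>a. pair a b p)"
  unfolding psnd_def pair_iff by blast

lemma pair_in:
  assumes "transitive D" "p \<in> D" "pair a b p" shows "a \<in> D" "b \<in> D"
proof -
  obtain u v where uv: "elts u = {a}" "elts v = {a, b}" "elts p = {u, v}"
    using assms(3) unfolding pair_iff by blast
  then have "v \<epsilon> p" "a \<epsilon> v" "b \<epsilon> v" unfolding elts_def by auto
  then show "a \<in> D" "b \<in> D" using assms transitiveD by blast+
qed

lemma fapp_in: "transitive D \<Longrightarrow> f \<in> D \<Longrightarrow> fapp f d z \<Longrightarrow> d \<in> D \<and> z \<in> D"
  unfolding fapp_def by (metis mem_elts pair_in transitiveD)

lemma rng_iff: "rng z f \<longleftrightarrow> (\<exists>d. fapp f d z)"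
  unfolding rng_def fapp_def psnd_iff by auto

lemma restr_iff: "restr f d g \<longleftrightarrow> elts g = {p \<in> elts f. \<exists>e\<in>elts d. pfst e p}"
  unfolding restr_def set_eq_iff by auto

lemma fapp_restr: "restr f d g \<Longrightarrow> fapp g e z \<longleftrightarrow> e \<epsilon> d \<and> fapp f e z"
  unfolding restr_def fapp_def pfst_iff by (metis mem_elts pair_inject)

subsection \<open>Ordinals\<close>

lemma ordinal_trans: "ordinal E x \<Longrightarrow> y \<epsilon> x \<Longrightarrow> z \<epsilon> y \<Longrightarrow> z \<epsilon> x"
  unfolding ordinal_def by blast

text \<open>If w is in z and z is in \<open>y\<close>, then w and \<open>y\<close> are both elements
  of \<open>x\<close>, hence comparable; \<open>y\<close> in w or \<open>y\<close> = w would create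
  a membership cycle.\<close>

lemma ordinal_elem: "ordinal E x \<Longrightarrow> y \<epsilon> x \<Longrightarrow> ordinal E y"
  unfolding ordinal_def by (metis no_3_cycle mem_asym)

text \<open>Double induction: if \<open>a\<close> and \<open>b\<close> are incomparable, the two
  induction hypotheses put each element of either one inside the other, and extensionality makes
  them equal.\<close>

lemma ordinal_linear:
  "ordinal E a \<Longrightarrow> ordinal E b \<Longrightarrow> a \<epsilon> b \<or> a = b \<or> b \<epsilon> a"
proof (induction a arbitrary: b rule: mem_induct)
  case (1 a)
  note IHa = 1(1) and oa = 1(2)
  show ?case using 1(3)
  proof (induction b rule: mem_induct)
    case (1 b)
    show ?case
    proof (rule ccontr)
      assume c: "\<not> ?thesis"
      have "x \<epsilon> a" if "x \<epsilon> b" for x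
        using "1.IH"[OF that ordinal_elem[OF 1(2) that]] c that ordinal_trans[OF 1(2)] by blast
      moreover have "x \<epsilon> b" if "x \<epsilon> a" for x
        using IHa[OF that ordinal_elem[OF oa that] 1(2)] c that ordinal_trans[OF oa] by blast
      ultimately have "elts a = elts b" by auto
      then show False using c elts_inject by blast
    qed
  qed
qed

lemma Dfn_ordinal: "Dfn (\<lambda>D s. ordinal E (s a))"
proof (rule Dfn_cong)
  show "Dfn (\<lambda>D s. (\<forall>y\<in>elts (s a). \<forall>z\<in>elts y. z \<epsilon> s a) \<and>
     (\<forall>y\<in>elts (s a). \<forall>z\<in>elts (s a). y \<epsilon> z \<or> y = z \<or> z \<epsilon> y))"
    by (intro Dfn_intros)
qed (unfold ordinal_def elts_def, blast)

text \<open>\<open>rank_le x a\<close> says that the rank of \<open>x\<close> is at most \<open>a\<close>, without forming ranks, which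
  need not exist in the universe.\<close>

inductive rank_le :: "'v \<Rightarrow> 'v \<Rightarrow> bool" where
  "(\<And>y. y \<epsilon> x \<Longrightarrow> \<exists>b. b \<epsilon> a \<and> rank_le y b) \<Longrightarrow> rank_le x a"

lemma rank_le_iff: "rank_le x a \<longleftrightarrow> (\<forall>y. y \<epsilon> x \<longrightarrow> (\<exists>b. b \<epsilon> a \<and> rank_le y b))"
  by (subst rank_le.simps) blast

lemma rank_le_mono: "rank_le x a \<Longrightarrow> elts a \<subseteq> elts b \<Longrightarrow> rank_le x b"
  by (subst rank_le_iff, subst (asm) rank_le_iff) (auto simp: subset_iff)

subsection \<open>Recursion in transitive models of ZF\<close>

lemma separation:
  assumes M: "transitive M" "models_ZF E M"
    and P: "Dfn (\<lambda>D s. P D (s 0) (s 1) (s 2) (s 3))"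
    and in_M: "A \<in> M" "a \<in> M" "b \<in> M" "c \<in> M"
  obtains B where "B \<in> M" "elts B = {x \<in> elts A. P M x a b c}"
proof -
  obtain p where p: "\<And>D s. transitive D \<Longrightarrow> range s \<subseteq> D \<Longrightarrow>
      P D (s 0) (s 1) (s 2) (s 3) \<longleftrightarrow> sat E D s p"
    by (rule DfnE[OF P that])
  define s where "s = (\<lambda>n::nat. if n = 1 then a else if n = 2 then b else c)"
  have "range s \<subseteq> M" using in_M by (auto simp: s_def)
  then obtain B where B: "B \<in> M" "\<forall>x\<in>M. x \<epsilon> B \<longleftrightarrow> x \<epsilon> A \<and> sat E M (s(0 := x)) p"
    using M(2) in_M(1) unfolding models_ZF_def Separation_schema_def by blast
  have "sat E M (s(0 := x)) p \<longleftrightarrow> P M x a b c" if "x \<in> M" for x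
    using p[of M "s(0 := x)"] M(1) that in_M by (auto simp: s_def image_subset_iff)
  then have "elts B = {x \<in> elts A. P M x a b c}"
    using B(2) transitiveD[OF M(1) B(1)] transitiveD[OF M(1) in_M(1)] by auto
  with B(1) show thesis by (rule that)
qed

lemma replacement:
  assumes M: "transitive M" "models_ZF E M"
    and P: "Dfn (\<lambda>D s. P D (s 0) (s 1) (s 2) (s 3))"
    and in_M: "A \<in> M" "a \<in> M" "b \<in> M"
    and uniq: "\<And>x. x \<epsilon> A \<Longrightarrow> \<exists>!y. y \<in> M \<and> P M x y a b"
  obtains B where "B \<in> M" "elts B = {y \<in> M. \<exists>x\<in>elts A. P M x y a b}"
proof -
  obtain p where p: "\<And>D s. transitive D \<Longrightarrow> range s \<subseteq> D \<Longrightarrow>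
      P D (s 0) (s 1) (s 2) (s 3) \<longleftrightarrow> sat E D s p"
    by (rule DfnE[OF P that])
  define s where "s = (\<lambda>n::nat. if n = 2 then a else b)"
  have s: "range s \<subseteq> M" using in_M by (auto simp: s_def)
  have sat: "sat E M (s(0 := x, 1 := y)) p \<longleftrightarrow> P M x y a b" if "x \<in> M" "y \<in> M" for x y
    using p[of M "s(0 := x, 1 := y)"] M(1) that in_M by (auto simp: s_def image_subset_iff)
  have uniq': "\<exists>!y. y \<in> M \<and> sat E M (s(0 := x, 1 := y)) p" if "x \<in> M" "x \<epsilon> A" for x
    using uniq[OF that(2)] sat[OF that(1)] by metis
  have "Replacement_schema E M" using M(2) by (simp add: models_ZF_def)
  note repl = this[unfolded Replacement_schema_def, THEN spec, THEN spec, THEN mp, OF s,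
      THEN bspec, OF in_M(1), THEN mp]
  have "\<exists>B\<in>M. \<forall>y\<in>M. y \<epsilon> B \<longleftrightarrow> (\<exists>x\<in>M. x \<epsilon> A \<and> sat E M (s(0 := x, 1 := y)) p)"
    by (rule repl) (use uniq' in blast)
  then obtain B where B: "B \<in> M"
      "\<forall>y\<in>M. y \<epsilon> B \<longleftrightarrow> (\<exists>x\<in>M. x \<epsilon> A \<and> sat E M (s(0 := x, 1 := y)) p)"
    by blast
  have "y \<epsilon> B \<longleftrightarrow> y \<in> M \<and> (\<exists>x\<in>elts A. P M x y a b)" for y
    using B(2) sat transitiveD[OF M(1) B(1)] transitiveD[OF M(1) in_M(1)]
    unfolding elts_def by blast
  then have "elts B = {y \<in> M. \<exists>x\<in>elts A. P M x y a b}"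
    unfolding elts_def by blast
  with B(1) show thesis by (rule that)
qed

section \<open>Basic set constructions inside a transitive model\<close>

lemma upair_exists:
  assumes M: "transitive M" "models_ZF E M" and ab: "a \<in> M" "b \<in> M"
  obtains p where "p \<in> M" "elts p = {a, b}"
proof -
  obtain p where p: "p \<in> M" "\<forall>z\<in>M. z \<epsilon> p \<longleftrightarrow> z = a \<or> z = b"
    using M(2) ab unfolding models_ZF_def Pairing_ax_def is_upair_def by blast
  then have "elts p = {a, b}" using transitiveD[OF M(1) p(1)] ab unfolding elts_def by blast
  with p(1) show thesis by (rule that)
qed

lemma pair_exists:
  assumes M: "transitive M" "models_ZF E M" and ab: "a \<in> M" "b \<in> M"
  obtains p where "p \<in> M" "pair a b p"
proof -
  obtain u where u: "u \<in> M" "elts u = {a, a}" by (rule upair_exists[OF M ab(1) ab(1)])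
  obtain v where v: "v \<in> M" "elts v = {a, b}" by (rule upair_exists[OF M ab])
  obtain p where p: "p \<in> M" "elts p = {u, v}" by (rule upair_exists[OF M u(1) v(1)])
  have "pair a b p" unfolding pair_iff using u v p by auto
  with p(1) show thesis by (rule that)
qed

lemma union_exists:
  assumes M: "transitive M" "models_ZF E M" and x: "x \<in> M"
  obtains u where "u \<in> M" "elts u = {z. \<exists>y\<in>elts x. z \<epsilon> y}"
proof -
  obtain u where u: "u \<in> M" "\<forall>z\<in>M. z \<epsilon> u \<longleftrightarrow> (\<exists>y\<in>M. y \<epsilon> x \<and> z \<epsilon> y)"
    using M(2) x unfolding models_ZF_def Union_ax_def by blast
  have "z \<epsilon> u \<longleftrightarrow> (\<exists>y\<in>elts x. z \<epsilon> y)" for z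
    using u(2) transitiveD[OF M(1) u(1)] transitiveD[OF M(1) x] transitiveD[OF M(1)]
    unfolding elts_def by blast
  then have "elts u = {z. \<exists>y\<in>elts x. z \<epsilon> y}" unfolding elts_def by blast
  with u(1) show thesis by (rule that)
qed

lemma powerset_exists:
  assumes M: "transitive M" "models_ZF E M" and x: "x \<in> M"
  obtains u where "u \<in> M" "elts u = {z \<in> M. elts z \<subseteq> elts x}"
proof -
  obtain u where u: "u \<in> M" "\<forall>z\<in>M. z \<epsilon> u \<longleftrightarrow> (\<forall>y\<in>M. y \<epsilon> z \<longrightarrow> y \<epsilon> x)"
    using M(2) x unfolding models_ZF_def Powerset_ax_def is_subset_def by blast
  have "z \<epsilon> u \<longleftrightarrow> z \<in> M \<and> elts z \<subseteq> elts x" for z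
    using u(2) transitiveD[OF M(1) u(1)] transitiveD[OF M(1)]
    unfolding elts_def by blast
  then have "elts u = {z \<in> M. elts z \<subseteq> elts x}" unfolding elts_def by blast
  with u(1) show thesis by (rule that)
qed

text \<open>A set-sized piece, with domain \<open>t\<close>, of the function defined by the
  recursion F(d) = G(a, F|d) with parameter \<open>a\<close>. Taking the restrictions as members of
  \<open>D\<close> keeps the condition first-order over \<open>D\<close>.\<close>

definition approx ::
    "('v set \<Rightarrow> 'v \<Rightarrow> 'v \<Rightarrow> 'v \<Rightarrow> bool) \<Rightarrow> 'v set \<Rightarrow> 'v \<Rightarrow> 'v \<Rightarrow> 'v \<Rightarrow> bool" where
  "approx G D a t f \<longleftrightarrow>
     (\<forall>p\<in>elts f. \<exists>d\<in>elts t. pfst d p) \<and>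
     (\<forall>d\<in>elts t. \<exists>g\<in>D. restr f d g \<and>
        (\<exists>z\<in>D. G D a g z \<and> fapp f d z \<and> (\<forall>p\<in>elts f. pfst d p \<longrightarrow> pair d z p)))"

lemma Dfn_approx:
  assumes "\<And>a b c. Dfn (\<lambda>D s. G D (s a) (s b) (s c))"
  shows "Dfn (\<lambda>D s. approx G D (s a) (s b) (s c))"
  unfolding approx_def by (intro Dfn_intros assms Dfn_pfst Dfn_pair Dfn_fapp Dfn_restr)

lemma approxD:
  assumes "approx G D a t f" "d \<epsilon> t"
  obtains g z where "g \<in> D" "restr f d g" "z \<in> D" "G D a g z" "fapp f d z"
    "\<forall>p. p \<epsilon> f \<longrightarrow> pfst d p \<longrightarrow> pair d z p"
proof -
  have "\<exists>g\<in>D. restr f d g \<and>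
        (\<exists>z\<in>D. G D a g z \<and> fapp f d z \<and> (\<forall>p\<in>elts f. pfst d p \<longrightarrow> pair d z p))"
    using assms unfolding approx_def elts_def by blast
  then show thesis using that unfolding elts_def by blast
qed

lemma approx_fapp_unique:
  assumes "approx G D a t f" "fapp f d z" "fapp f d w" shows "z = w"
proof -
  obtain p q where pq: "p \<epsilon> f" "pair d z p" "q \<epsilon> f" "pair d w q"
    using assms(2,3) unfolding fapp_def by auto
  obtain e where e: "e \<epsilon> t" "pfst e p" using assms(1) pq(1) unfolding approx_def elts_def by blast
  then have "e = d" using pq(2) pair_inject pfst_iff by blast
  then obtain v where "\<forall>p. p \<epsilon> f \<longrightarrow> pfst d p \<longrightarrow> pair d v p"
    using approxD[OF assms(1) e(1)] by metis
  then show ?thesis using pq pair_inject pfst_iff by metis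
qed

text \<open>Induction on \<open>d\<close>: the functions have the same pairs below \<open>d\<close>,
  so their restrictions to \<open>d\<close> coincide and \<open>G\<close> yields the same
  value.\<close>

lemma approx_agree:
  assumes uniq: "\<forall>g\<in>D. \<forall>z\<in>D. \<forall>w\<in>D. G D a g z \<longrightarrow> G D a g w \<longrightarrow> z = w"
    and f: "approx G D a t f" "ordinal E t" and f': "approx G D a t' f'" "ordinal E t'"
    and "d \<epsilon> t" "d \<epsilon> t'" "pfst d p"
  shows "p \<epsilon> f \<longleftrightarrow> p \<epsilon> f'"
  using assms(6-8)
proof (induction d arbitrary: p rule: mem_induct)
  case (1 d)
  obtain g z where g: "g \<in> D" "restr f d g" "z \<in> D" "G D a g z" "fapp f d z"
    "\<forall>p. p \<epsilon> f \<longrightarrow> pfst d p \<longrightarrow> pair d z p"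
    by (rule approxD[OF f(1) \<open>d \<epsilon> t\<close>])
  obtain g' z' where g': "g' \<in> D" "restr f' d g'" "z' \<in> D" "G D a g' z'" "fapp f' d z'"
    "\<forall>p. p \<epsilon> f' \<longrightarrow> pfst d p \<longrightarrow> pair d z' p"
    by (rule approxD[OF f'(1) \<open>d \<epsilon> t'\<close>])
  have "p \<epsilon> f \<longleftrightarrow> p \<epsilon> f'" if "e \<epsilon> d" "pfst e p" for e p
    using that 1 ordinal_trans f(2) f'(2) by blast
  then have "elts g = elts g'"
    using g(2) g'(2) unfolding restr_iff elts_def by blast
  then have "g' = g" by (simp add: elts_inject)
  then have "z' = z" using uniq g g' by blast
  then show ?case using g(5,6) g'(5,6) \<open>pfst d p\<close> unfolding fapp_def by (metis mem_elts pair_unique)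
qed

text \<open>For \<open>e\<close> in \<open>d\<close>, transitivity of \<open>d\<close> makes the
  restriction of \<open>g\<close> to \<open>e\<close> the same as that of \<open>f\<close>.\<close>

lemma approx_restr:
  assumes f: "approx G D a t f" "ordinal E t" and g: "d \<epsilon> t" "restr f d g"
  shows "approx G D a d g"
proof -
  have "\<exists>h\<in>D. restr g e h \<and>
        (\<exists>z\<in>D. G D a h z \<and> fapp g e z \<and> (\<forall>p\<in>elts g. pfst e p \<longrightarrow> pair e z p))"
    if e: "e \<epsilon> d" for e
  proof -
    have "e \<epsilon> t" using e f(2) g(1) ordinal_trans by blast
    then obtain h z where h: "h \<in> D" "restr f e h" "z \<in> D" "G D a h z" "fapp f e z"
      "\<forall>p. p \<epsilon> f \<longrightarrow> pfst e p \<longrightarrow> pair e z p"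
      by (rule approxD[OF f(1)])
    have "x \<epsilon> d" if "x \<epsilon> e" for x
      using that e ordinal_trans[OF ordinal_elem[OF f(2) g(1)]] by blast
    then have "restr g e h" using g(2) h(2) unfolding restr_iff elts_def by blast
    moreover have "fapp g e z" using fapp_restr[OF g(2)] e h(5) by blast
    moreover have "\<forall>p\<in>elts g. pfst e p \<longrightarrow> pair e z p"
      using h(6) g(2) unfolding restr_def by auto
    ultimately show ?thesis using h(1,3,4) by blast
  qed
  then show ?thesis using g(2) unfolding approx_def restr_def by auto
qed

lemma approx_unique:
  assumes uniq: "\<forall>g\<in>D. \<forall>z\<in>D. \<forall>w\<in>D. G D a g z \<longrightarrow> G D a g w \<longrightarrow> z = w"
    and f: "approx G D a t f" "approx G D a t g" "ordinal E t"
  shows "f = g"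
proof -
  have "p \<epsilon> f \<longleftrightarrow> p \<epsilon> g" for p
  proof (cases "\<exists>d. d \<epsilon> t \<and> pfst d p")
    case True
    then show ?thesis using approx_agree[OF uniq f(1,3) f(2,3)] by blast
  next
    case False
    then show ?thesis using f(1,2) unfolding approx_def elts_def by blast
  qed
  then have "elts f = elts g" unfolding elts_def by blast
  then show ?thesis by (simp add: elts_inject)
qed

text \<open>Induction on \<open>t\<close>: each d in \<open>t\<close> has a unique approximation f_d
  with domain d, and Replacement collects the pairs (d, G(a, f_d)) into an approximation on
  \<open>t\<close>.\<close>

lemma approx_exists:
  assumes M: "transitive M" "models_ZF E M"
    and G: "\<And>a b c. Dfn (\<lambda>D s. G D (s a) (s b) (s c))" and "a \<in> M"
    and tot: "\<And>g. g \<in> M \<Longrightarrow> \<exists>!z. z \<in> M \<and> G M a g z"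
  shows "t \<in> M \<Longrightarrow> ordinal E t \<Longrightarrow> \<exists>f\<in>M. approx G M a t f"
proof (induction t rule: mem_induct)
  case (1 t)
  have uniq: "\<forall>g\<in>M. \<forall>z\<in>M. \<forall>w\<in>M. G M a g z \<longrightarrow> G M a g w \<longrightarrow> z = w"
    using tot by blast
  define R where "R = (\<lambda>D d p a. \<exists>f\<in>D. approx G D a d f \<and> (\<exists>z\<in>D. G D a f z \<and> pair d z p))"
  have R: "Dfn (\<lambda>D s. R D (s 0) (s 1) (s 2))"
    unfolding R_def by (intro Dfn_intros Dfn_approx G Dfn_pair)
  have in_M: "d \<in> M" if "d \<epsilon> t" for d using that 1(2) M(1) transitiveD by blast
  have ord: "ordinal E d" if "d \<epsilon> t" for d using that 1(3) ordinal_elem by blast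
  have ex: "\<exists>f\<in>M. approx G M a d f" if "d \<epsilon> t" for d
    using 1(1)[OF that in_M[OF that] ord[OF that]] .
  have "\<exists>!p. p \<in> M \<and> R M d p a" if d: "d \<epsilon> t" for d
  proof -
    obtain f where f: "f \<in> M" "approx G M a d f" using ex[OF d] by blast
    obtain z where z: "z \<in> M" "G M a f z" using tot[OF f(1)] by blast
    obtain p where p: "p \<in> M" "pair d z p" by (rule pair_exists[OF M in_M[OF d] z(1)])
    show ?thesis
    proof (rule ex1I[of _ p])
      show "p \<in> M \<and> R M d p a" using f z p unfolding R_def by blast
      fix q assume "q \<in> M \<and> R M d q a"
      then obtain f' z' where q: "f' \<in> M" "approx G M a d f'" "z' \<in> M" "G M a f' z'" "pair d z' q"
        unfolding R_def by blast
      have "f' = f" using approx_unique[OF uniq q(2) f(2) ord[OF d]] .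
      then have "z' = z" using uniq q f z by blast
      then show "q = p" using q p pair_unique by blast
    qed
  qed
  then obtain f where f: "f \<in> M" "elts f = {p \<in> M. \<exists>d\<in>elts t. R M d p a}"
    using replacement[OF M, of "\<lambda>D d p a b. R D d p a" t a a] R 1(2) \<open>a \<in> M\<close> by blast
  have f_iff: "p \<epsilon> f \<longleftrightarrow> p \<in> M \<and> (\<exists>d. d \<epsilon> t \<and> R M d p a)" for p
    using f(2) unfolding elts_def by blast
  have R_iff: "R M d p a \<longleftrightarrow> (\<exists>z\<in>M. G M a g z \<and> pair d z p)"
    if "d \<epsilon> t" "g \<in> M" "approx G M a d g" for d g p
    using that(2,3) approx_unique[OF uniq _ that(3) ord[OF that(1)]] unfolding R_def by blast
  have "approx G M a t f"
    unfolding approx_def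
  proof (intro conjI ballI)
    fix p assume "p \<in> elts f"
    then show "\<exists>d\<in>elts t. pfst d p" unfolding f(2) R_def pfst_iff by blast
  next
    fix d assume "d \<in> elts t"
    then have d: "d \<epsilon> t" by simp
    obtain g where g: "g \<in> M" "approx G M a d g" using ex[OF d] by blast
    obtain z where z: "z \<in> M" "G M a g z" using tot[OF g(1)] by blast
    obtain q where q: "q \<in> M" "pair d z q" by (rule pair_exists[OF M in_M[OF d] z(1)])
    \<comment> \<open>Below \<open>d\<close> the collected \<open>f\<close> agrees with
      \<open>g\<close>: the approximation at \<open>e\<close> is the restriction of \<open>g\<close>
      to \<open>e\<close>, so both assign the value \<open>w\<close>.\<close>
    have *: "p \<epsilon> g \<longleftrightarrow> p \<epsilon> f" if e: "e \<epsilon> d" and p: "pfst e p" for e p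
    proof -
      have et: "e \<epsilon> t" using ordinal_trans[OF 1(3) d e] .
      obtain h w where h: "h \<in> M" "restr g e h" "w \<in> M" "G M a h w" "fapp g e w"
        "\<forall>p. p \<epsilon> g \<longrightarrow> pfst e p \<longrightarrow> pair e w p"
        by (rule approxD[OF g(2) e])
      have ah: "approx G M a e h" by (rule approx_restr[OF g(2) ord[OF d] e h(2)])
      have "p \<epsilon> f \<longleftrightarrow> p \<in> M \<and> R M e p a"
        unfolding f_iff using et p unfolding R_def pfst_iff by (metis pair_inject)
      also have "\<dots> \<longleftrightarrow> p \<in> M \<and> pair e w p"
        unfolding R_iff[OF et h(1) ah] using h(3,4) uniq h(1) by blast
      also have "\<dots> \<longleftrightarrow> p \<epsilon> g"
        using h(5,6) p transitiveD[OF M(1) g(1)] unfolding fapp_def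
        by (metis mem_elts pair_unique)
      finally show ?thesis by blast
    qed
    have "restr f d g"
      using * g(2) unfolding restr_iff approx_def elts_def by blast
    moreover have "fapp f d z"
    proof -
      have "R M d q a" unfolding R_iff[OF d g] using q z by blast
      then have "q \<epsilon> f" unfolding f_iff using q(1) d by blast
      then show ?thesis unfolding fapp_def elts_def using q(2) by blast
    qed
    moreover have "pair d z p" if "p \<epsilon> f" "pfst d p" for p
    proof -
      have "R M d p a" using that unfolding f_iff R_def pfst_iff by (metis pair_inject)
      then show ?thesis using R_iff[OF d g] uniq g(1) z by blast
    qed
    ultimately show "\<exists>g\<in>M. restr f d g \<and>
        (\<exists>z\<in>M. G M a g z \<and> fapp f d z \<and> (\<forall>p\<in>elts f. pfst d p \<longrightarrow> pair d z p))"
      using g(1) z unfolding elts_def by blast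
  qed
  then show ?case using f(1) by blast
qed

subsection \<open>Levels of the cumulative hierarchy\<close>

definition level_step :: "'v set \<Rightarrow> 'v \<Rightarrow> 'v \<Rightarrow> 'v \<Rightarrow> bool" where
  "level_step D a f z \<longleftrightarrow> (\<forall>x\<in>D. x \<epsilon> z \<longleftrightarrow> (\<forall>y\<in>elts x. \<exists>w\<in>D. rng w f \<and> y \<epsilon> w))"

text \<open>The second argument of \<^const>\<open>level_step\<close> is a dummy.\<close>

definition level :: "'v set \<Rightarrow> 'v \<Rightarrow> 'v \<Rightarrow> bool" where
  "level D t v \<longleftrightarrow> (\<exists>f\<in>D. approx level_step D t t f \<and> level_step D t f v)"

lemma Dfn_level_step: "Dfn (\<lambda>D s. level_step D (s a) (s b) (s c))"
  unfolding level_step_def by (intro Dfn_intros Dfn_rng)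

lemma Dfn_level: "Dfn (\<lambda>D s. level D (s a) (s b))"
  unfolding level_def by (intro Dfn_intros Dfn_approx Dfn_level_step)

text \<open>The value at \<open>t\<close> is V_(t+1) in the sense of \<open>D\<close>:
  \<open>x\<close> enters exactly when each of its elements lies in an earlier level, which is the
  recursive clause of \<open>rank_le\<close>.\<close>

lemma level_step_elts:
  assumes D: "transitive D"
  shows "ordinal E t \<Longrightarrow> f \<in> D \<Longrightarrow> approx level_step D a t f \<Longrightarrow> level_step D a f v \<Longrightarrow>
    v \<in> D \<Longrightarrow> elts v = {x \<in> D. rank_le x t}"
proof (induction t arbitrary: f v rule: mem_induct)
  case (1 t)
  have IH: "\<exists>z. fapp f d z \<and> elts z = {x \<in> D. rank_le x d}" if d: "d \<epsilon> t" for d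
  proof -
    obtain g z where g: "g \<in> D" "restr f d g" "z \<in> D" "level_step D a g z" "fapp f d z"
      by (rule approxD[OF 1(4) d])
    have "approx level_step D a d g" by (rule approx_restr[OF 1(4,2) d g(2)])
    then show ?thesis using 1(1)[OF d ordinal_elem[OF 1(2) d] g(1) _ g(4,3)] g(5) by blast
  qed
  have rng: "rng w f \<longleftrightarrow> (\<exists>d. d \<epsilon> t \<and> elts w = {x \<in> D. rank_le x d})" for w
  proof
    assume "rng w f"
    then obtain d p where p: "pair d w p" "p \<epsilon> f" unfolding rng_def psnd_iff elts_def by blast
    then obtain e where "e \<epsilon> t" "pfst e p" using 1(4) unfolding approx_def elts_def by blast
    then have d: "d \<epsilon> t" using p pair_inject pfst_iff by blast
    obtain z where z: "fapp f d z" "elts z = {x \<in> D. rank_le x d}" using IH[OF d] by blast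
    have "fapp f d w" using p unfolding fapp_def elts_def by blast
    then have "z = w" using approx_fapp_unique[OF 1(4) z(1)] by blast
    then show "\<exists>d. d \<epsilon> t \<and> elts w = {x \<in> D. rank_le x d}" using d z(2) by blast
  next
    assume "\<exists>d. d \<epsilon> t \<and> elts w = {x \<in> D. rank_le x d}"
    then show "rng w f" unfolding rng_iff using IH elts_inject by metis
  qed
  have "x \<epsilon> v \<longleftrightarrow> rank_le x t" if x: "x \<in> D" for x
  proof -
    have "x \<epsilon> v \<longleftrightarrow> (\<forall>y\<in>elts x. \<exists>w\<in>D. rng w f \<and> y \<epsilon> w)"
      using 1(5) x unfolding level_step_def by blast
    also have "\<dots> \<longleftrightarrow> (\<forall>y\<in>elts x. \<exists>d. d \<epsilon> t \<and> rank_le y d)"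
    proof (rule ball_cong[OF refl])
      fix y assume "y \<in> elts x"
      then have y: "y \<in> D" using transitiveD[OF D x] by simp
      show "(\<exists>w\<in>D. rng w f \<and> y \<epsilon> w) \<longleftrightarrow> (\<exists>d. d \<epsilon> t \<and> rank_le y d)"
      proof
        assume "\<exists>w\<in>D. rng w f \<and> y \<epsilon> w"
        then show "\<exists>d. d \<epsilon> t \<and> rank_le y d" unfolding rng elts_def by blast
      next
        assume "\<exists>d. d \<epsilon> t \<and> rank_le y d"
        then obtain d z where d: "d \<epsilon> t" "rank_le y d" "fapp f d z" "elts z = {x \<in> D. rank_le x d}"
          using IH by blast
        then have "y \<epsilon> z" using y unfolding elts_def by blast
        then show "\<exists>w\<in>D. rng w f \<and> y \<epsilon> w"
          using fapp_in[OF D 1(3) d(3)] d(3) unfolding rng_iff by blast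
      qed
    qed
    also have "\<dots> \<longleftrightarrow> rank_le x t" unfolding rank_le_iff[of x] elts_def by blast
    finally show ?thesis .
  qed
  then show ?case using transitiveD[OF D 1(6)] unfolding elts_def by blast
qed

lemma level_elts:
  "transitive D \<Longrightarrow> ordinal E t \<Longrightarrow> v \<in> D \<Longrightarrow> level D t v \<Longrightarrow> elts v = {x \<in> D. rank_le x t}"
  unfolding level_def using level_step_elts by blast

lemma elts_collect_unique:
  assumes "transitive D" "z \<in> D" "w \<in> D" "\<forall>x\<in>D. x \<epsilon> z \<longleftrightarrow> P x" "\<forall>x\<in>D. x \<epsilon> w \<longleftrightarrow> P x"
  shows "z = w"
proof -
  have "elts z = elts w"
    using assms(4,5) transitiveD[OF assms(1,2)] transitiveD[OF assms(1,3)]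
    unfolding elts_def by blast
  then show ?thesis by (simp add: elts_inject)
qed

text \<open>The second component of a Kuratowski pair lies in an element of it, so the double union
  of \<open>f\<close> contains the range.\<close>

lemma rng_in_Union:
  assumes M: "transitive M" "models_ZF E M" and f: "f \<in> M"
  obtains u where "u \<in> M" "\<forall>w. rng w f \<longrightarrow> w \<epsilon> u"
proof -
  obtain u1 where u1: "u1 \<in> M" "elts u1 = {z. \<exists>y\<in>elts f. z \<epsilon> y}" by (rule union_exists[OF M f])
  obtain u2 where u2: "u2 \<in> M" "elts u2 = {z. \<exists>y\<in>elts u1. z \<epsilon> y}"
    by (rule union_exists[OF M u1(1)])
  have "w \<epsilon> u2" if w: "rng w f" for w
  proof -
    obtain p v where "p \<epsilon> f" "v \<epsilon> p" "w \<epsilon> v"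
      using w unfolding rng_def psnd_iff pair_iff elts_def by blast
    then show ?thesis using u1 u2 unfolding elts_def by blast
  qed
  with u2(1) show thesis using that by blast
qed

text \<open>Every candidate is a subset of the union of a set containing the range of
  \<open>g\<close>, so Power set bounds the candidates and Separation selects among them.\<close>

lemma level_step_total:
  assumes M: "transitive M" "models_ZF E M" and "a \<in> M" and g: "g \<in> M"
  shows "\<exists>!z. z \<in> M \<and> level_step M a g z"
proof -
  obtain u where u: "u \<in> M" "\<forall>w. rng w g \<longrightarrow> w \<epsilon> u" by (rule rng_in_Union[OF M g])
  obtain u1 where u1: "u1 \<in> M" "elts u1 = {z. \<exists>y\<in>elts u. z \<epsilon> y}"
    by (rule union_exists[OF M u(1)])
  obtain u2 where u2: "u2 \<in> M" "elts u2 = {z \<in> M. elts z \<subseteq> elts u1}"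
    by (rule powerset_exists[OF M u1(1)])
  define P where "P = (\<lambda>D x g (b :: 'v) (c :: 'v). \<forall>y\<in>elts x. \<exists>w\<in>D. rng w g \<and> y \<epsilon> w)"
  have "Dfn (\<lambda>D s. P D (s 0) (s 1) (s 2) (s 3))"
    unfolding P_def by (intro Dfn_intros Dfn_rng)
  then obtain z where z: "z \<in> M" "elts z = {x \<in> elts u2. P M x g a a}"
    using separation[OF M _ u2(1) g \<open>a \<in> M\<close> \<open>a \<in> M\<close>] by blast
  have "x \<epsilon> z \<longleftrightarrow> (\<forall>y\<in>elts x. \<exists>w\<in>M. rng w g \<and> y \<epsilon> w)" if x: "x \<in> M" for x
  proof
    assume "x \<epsilon> z"
    then show "\<forall>y\<in>elts x. \<exists>w\<in>M. rng w g \<and> y \<epsilon> w" using z(2) unfolding P_def elts_def by blast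
  next
    assume *: "\<forall>y\<in>elts x. \<exists>w\<in>M. rng w g \<and> y \<epsilon> w"
    then have "elts x \<subseteq> elts u1" using u(2) u1(2) unfolding elts_def by blast
    then have "x \<in> elts u2" using u2(2) x by blast
    then show "x \<epsilon> z" using z(2) * unfolding P_def elts_def by blast
  qed
  then have step: "level_step M a g z" unfolding level_step_def by blast
  show ?thesis
  proof (rule ex1I[of _ z])
    show "z \<in> M \<and> level_step M a g z" using z(1) step by blast
    show "w = z" if "w \<in> M \<and> level_step M a g w" for w
      using that elts_collect_unique[OF M(1) _ z(1) _ step[unfolded level_step_def]]
      unfolding level_step_def by blast
  qed
qed

lemma level_exists:
  assumes M: "transitive M" "models_ZF E M" and t: "t \<in> M" "ordinal E t"
  obtains v where "v \<in> M" "level M t v"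
proof -
  obtain f where f: "f \<in> M" "approx level_step M t t f"
    using approx_exists[where G = level_step, OF M Dfn_level_step t(1) level_step_total[OF M t(1)] t] by blast
  obtain v where v: "v \<in> M" "level_step M t f v"
    using level_step_total[OF M t(1) f(1)] by blast
  have "level M t v" unfolding level_def using f v(2) by blast
  with v(1) show thesis by (rule that)
qed

lemma succ_exists:
  assumes M: "transitive M" "models_ZF E M" and t: "t \<in> M"
  obtains u where "u \<in> M" "elts u = insert t (elts t)"
proof -
  obtain a where a: "a \<in> M" "elts a = {t, t}" by (rule upair_exists[OF M t t])
  obtain b where b: "b \<in> M" "elts b = {t, a}" by (rule upair_exists[OF M t a(1)])
  obtain u where u: "u \<in> M" "elts u = {z. \<exists>y\<in>elts b. z \<epsilon> y}" by (rule union_exists[OF M b(1)])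
  have "elts u = (\<Union>y\<in>elts b. elts y)" unfolding u(2) by (simp add: elts_def UNION_eq)
  also have "\<dots> = insert t (elts t)" unfolding b(2) using a(2) by simp
  finally show thesis by (rule that[OF u(1)])
qed

lemma ordinal_succ:
  assumes "ordinal E t" "elts u = insert t (elts t)" shows "ordinal E u"
proof -
  have "z \<epsilon> u \<longleftrightarrow> z = t \<or> z \<epsilon> t" for z using assms(2) by (metis insert_iff mem_elts)
  then show ?thesis using assms(1) unfolding ordinal_def by metis
qed

lemma ordinal_Union:
  assumes "\<And>y. y \<epsilon> b \<Longrightarrow> ordinal E y" "elts u = {z. \<exists>y\<in>elts b. z \<epsilon> y}"
  shows "ordinal E u"
proof -
  have u: "z \<epsilon> u \<longleftrightarrow> (\<exists>y. y \<epsilon> b \<and> z \<epsilon> y)" for z using assms(2) unfolding elts_def by blast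
  have "ordinal E z" if "z \<epsilon> u" for z using that assms(1) ordinal_elem unfolding u by blast
  then have "y \<epsilon> z \<or> y = z \<or> z \<epsilon> y" if "y \<epsilon> u" "z \<epsilon> u" for y z
    using that ordinal_linear by blast
  moreover have "z \<epsilon> u" if "y \<epsilon> u" "z \<epsilon> y" for y z
    using that assms(1) ordinal_trans unfolding u by blast
  ultimately show ?thesis unfolding ordinal_def[of E u] by blast
qed

text \<open>By induction the elements of \<open>x\<close> have rank bounds. Replacement collects the
  least ones, and the successor of their union bounds \<open>x\<close>.\<close>

lemma rank_exists:
  assumes M: "transitive M" "models_ZF E M"
  shows "x \<in> M \<Longrightarrow> \<exists>t\<in>M. ordinal E t \<and> rank_le x t"
proof (induction x rule: mem_induct)
  case (1 x)
  \<comment> \<open>\<open>rank_le\<close> is inductive outside the object language; membership in a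
    level expresses it by a formula. \<open>R\<close> selects the least bound to give Replacement a
    unique value.\<close>
  define L where "L = (\<lambda>D y t. \<exists>v\<in>D. level D t v \<and> y \<epsilon> v)"
  define R where "R = (\<lambda>D y t (a :: 'v) (b :: 'v). ordinal E t \<and> L D y t \<and> (\<forall>r\<in>elts t. \<not> L D y r))"
  have "Dfn (\<lambda>D s. L D (s a) (s b))" for a b
    unfolding L_def by (intro Dfn_intros Dfn_level)
  then have R: "Dfn (\<lambda>D s. R D (s 0) (s 1) (s 2) (s 3))"
    unfolding R_def by (intro Dfn_intros Dfn_ordinal)
  have L: "L M y t \<longleftrightarrow> rank_le y t" if yt: "y \<in> M" "t \<in> M" "ordinal E t" for y t
  proof -
    obtain v where v: "v \<in> M" "level M t v" by (rule level_exists[OF M yt(2,3)])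
    show ?thesis
      using v level_elts[OF M(1) yt(3)] yt(1) unfolding L_def elts_def by blast
  qed
  have R_iff: "R M y t a b \<longleftrightarrow> ordinal E t \<and> rank_le y t \<and> (\<forall>r. r \<epsilon> t \<longrightarrow> \<not> rank_le y r)"
    if "y \<in> M" "t \<in> M" for y t a b
    using L[OF that(1)] that(2) transitiveD[OF M(1) that(2)] ordinal_elem
    unfolding R_def elts_def by blast
  have y_in: "y \<in> M" if "y \<epsilon> x" for y using transitiveD[OF M(1) 1(2) that] .
  have ex: "\<exists>!t. t \<in> M \<and> R M y t x x" if y: "y \<epsilon> x" for y
  proof -
    have "\<exists>t\<in>M. ordinal E t \<and> rank_le y t \<and> (\<forall>r. r \<epsilon> t \<longrightarrow> \<not> rank_le y r)"
      if "t \<in> M" "ordinal E t" "rank_le y t" for t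
      using that
    proof (induction t rule: mem_induct)
      case (1 t)
      then show ?case using transitiveD[OF M(1) 1(2)] ordinal_elem[OF 1(3)] by blast
    qed
    then have "\<exists>t. t \<in> M \<and> R M y t x x" using 1(1)[OF y y_in[OF y]] R_iff[OF y_in[OF y]] by blast
    moreover have "t = r" if "t \<in> M" "R M y t x x" "r \<in> M" "R M y r x x" for t r
      using that ordinal_linear unfolding R_iff[OF y_in[OF y] that(1)] R_iff[OF y_in[OF y] that(3)]
      by blast
    ultimately show ?thesis by blast
  qed
  obtain B where B: "B \<in> M" "elts B = {t \<in> M. \<exists>y\<in>elts x. R M y t x x}"
    by (rule replacement[OF M R 1(2) 1(2) 1(2) ex])
  obtain u where u: "u \<in> M" "elts u = {z. \<exists>y\<in>elts B. z \<epsilon> y}" by (rule union_exists[OF M B(1)])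
  obtain t where t: "t \<in> M" "elts t = insert u (elts u)" by (rule succ_exists[OF M u(1)])
  have "ordinal E y" if "y \<epsilon> B" for y using that B(2) unfolding R_def elts_def by blast
  then have "ordinal E u" using u(2) by (rule ordinal_Union)
  then have "ordinal E t" using t(2) by (rule ordinal_succ)
  moreover have "rank_le x t"
    unfolding rank_le_iff[of x]
  proof (intro allI impI)
    fix y assume y: "y \<epsilon> x"
    then obtain r where r: "r \<in> M" "R M y r x x" using ex by blast
    then have "r \<in> elts B" using B(2) y by auto
    then have "elts r \<subseteq> elts u" using u(2) unfolding elts_def by blast
    moreover have "rank_le y r" using r R_iff[OF y_in[OF y] r(1)] by blast
    ultimately have "rank_le y u" using rank_le_mono by blast
    moreover have "u \<epsilon> t" using t(2) unfolding elts_def by blast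
    ultimately show "\<exists>b. b \<epsilon> t \<and> rank_le y b" by blast
  qed
  ultimately show ?case using t(1) by blast
qed

subsection \<open>Elementary embeddings\<close>

abbreviation elem :: "'v set \<Rightarrow> 'v set \<Rightarrow> ('v \<Rightarrow> 'v) \<Rightarrow> bool" where
  "elem \<equiv> elementary_embedding E"

lemma elem_in: "elem M N j \<Longrightarrow> x \<in> M \<Longrightarrow> j x \<in> N"
  unfolding elementary_embedding_def by blast

lemma elem_Dfn:
  assumes j: "elem M N j" and "transitive M" "transitive N" and P: "Dfn P" and s: "range s \<subseteq> M"
  shows "P M s \<longleftrightarrow> P N (\<lambda>n. j (s n))"
proof -
  obtain p where p: "\<And>D s. transitive D \<Longrightarrow> range s \<subseteq> D \<Longrightarrow> P D s \<longleftrightarrow> sat E D s p"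
    by (rule DfnE[OF P that])
  have js: "range (\<lambda>n. j (s n)) \<subseteq> N" using s elem_in[OF j] by auto
  have "sat E M s p \<longleftrightarrow> sat E N (j \<circ> s) p"
    using j s unfolding elementary_embedding_def by blast
  then show ?thesis using p[OF assms(2) s] p[OF assms(3) js] by (simp add: comp_def)
qed

lemma elem_Dfn4:
  assumes j: "elem M N j" "transitive M" "transitive N"
    and P: "Dfn (\<lambda>D s. P D (s 0) (s 1) (s 2) (s 3))"
    and in_M: "x \<in> M" "y \<in> M" "z \<in> M" "w \<in> M"
  shows "P M x y z w \<longleftrightarrow> P N (j x) (j y) (j z) (j w)"
proof -
  define s where "s = (\<lambda>n::nat. if n = 0 then x else if n = 1 then y else if n = 2 then z else w)"
  have "range s \<subseteq> M" using in_M by (auto simp: s_def)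
  from elem_Dfn[OF j P this] show ?thesis by (simp add: s_def)
qed

lemma elem_Dfn3:
  assumes "elem M N j" "transitive M" "transitive N"
    and "Dfn (\<lambda>D s. P D (s 0) (s 1) (s 2))" and "x \<in> M" "y \<in> M" "z \<in> M"
  shows "P M x y z \<longleftrightarrow> P N (j x) (j y) (j z)"
  using elem_Dfn4[of M N j "\<lambda>D x y z w. P D x y z" x y z z] assms by blast

lemma elem_Dfn2:
  assumes "elem M N j" "transitive M" "transitive N"
    and "Dfn (\<lambda>D s. P D (s 0) (s 1))" and "x \<in> M" "y \<in> M"
  shows "P M x y \<longleftrightarrow> P N (j x) (j y)"
  using elem_Dfn4[of M N j "\<lambda>D x y z w. P D x y" x y y y] assms by blast

lemma elem_Dfn1:
  assumes "elem M N j" "transitive M" "transitive N"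
    and "Dfn (\<lambda>D s. P D (s 0))" and "x \<in> M"
  shows "P M x \<longleftrightarrow> P N (j x)"
  using elem_Dfn4[of M N j "\<lambda>D x y z w. P D x" x x x x] assms by blast

lemma elem_mem:
  "elem M N j \<Longrightarrow> transitive M \<Longrightarrow> transitive N \<Longrightarrow> x \<in> M \<Longrightarrow> y \<in> M \<Longrightarrow> x \<epsilon> y \<longleftrightarrow> j x \<epsilon> j y"
  by (rule elem_Dfn2[of M N j "\<lambda>D x y. x \<epsilon> y"]) (auto intro: Dfn_mem)

lemma elem_ordinal:
  "elem M N j \<Longrightarrow> transitive M \<Longrightarrow> transitive N \<Longrightarrow> x \<in> M \<Longrightarrow> ordinal E x \<longleftrightarrow> ordinal E (j x)"
  by (rule elem_Dfn1[of M N j "\<lambda>D x. ordinal E x"]) (auto intro: Dfn_ordinal)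

text \<open>Serves for universal statements whose instances in \<open>N\<close> need not be values
  of \<open>i\<close>. A counterexample makes the existential closure of the negated formula true at
  \<open>i c\<close>; elementarity pulls this back to \<open>c\<close>.\<close>

lemma elem_univ:
  assumes i: "elem M N i" and M: "transitive M" and N: "transitive N" and P: "Dfn P"
    and c: "c \<in> M" and all: "\<And>s. range s \<subseteq> M \<Longrightarrow> s 0 = c \<Longrightarrow> P M s"
    and s: "range s \<subseteq> N" "s 0 = i c"
  shows "P N s"
proof (rule ccontr)
  assume neg: "\<not> P N s"
  obtain p where p: "\<And>D s. transitive D \<Longrightarrow> range s \<subseteq> D \<Longrightarrow> P D s \<longleftrightarrow> sat E D s p"
    by (rule DfnE[OF P that])
  obtain k where k: "\<And>D s s'. (\<forall>n<k. s n = s' n) \<Longrightarrow> sat E D s p = sat E D s' p"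
    using sat_finite_support[of E p] by blast
  define q where "q = exists_vars [1..<k] (Neg p)"
  \<comment> \<open>Resetting the other variables to \<open>i c\<close> leaves the truth of
    \<open>p\<close> unchanged and makes \<open>s'\<close> a variant of a constant
    assignment.\<close>
  define s' where "s' = (\<lambda>n. if n \<in> set [1..<k] then s n else i c)"
  have ic: "i c \<in> N" using elem_in[OF i c] .
  have "range s' \<subseteq> N" using s(1) ic by (auto simp: s'_def)
  moreover have "sat E N s' p = sat E N s p"
    by (rule k) (use s(2) in \<open>auto simp: s'_def not_le\<close>)
  then have "sat E N s' (Neg p)" using neg p[OF N s(1)] by simp
  moreover have "\<forall>n. n \<notin> set [1..<k] \<longrightarrow> s' n = i c" by (simp add: s'_def)
  moreover have icr: "range (\<lambda>n::nat. i c) \<subseteq> N" using ic by auto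
  ultimately have "sat E N (\<lambda>n. i c) q"
    unfolding q_def sat_exists_vars[OF icr] by blast
  moreover have cr: "range (\<lambda>n::nat. c) \<subseteq> M" using c by auto
  then have "sat E M (\<lambda>n. c) q \<longleftrightarrow> sat E N (i \<circ> (\<lambda>n. c)) q"
    using i unfolding elementary_embedding_def by blast
  ultimately have "sat E M (\<lambda>n. c) q" by (simp add: comp_def)
  then obtain t where t: "range t \<subseteq> M" "\<forall>n. n \<notin> set [1..<k] \<longrightarrow> t n = c" "sat E M t (Neg p)"
    unfolding q_def sat_exists_vars[OF cr] by blast
  have "t 0 = c" using t(2) by simp
  then show False using all[OF t(1)] p[OF M t(1)] t(3) by simp
qed

lemma Dfn_reindex3:
  assumes "Dfn (\<lambda>D s. J D (s 0) (s 1) (s 2))"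
  shows "Dfn (\<lambda>D s. J D (s a) (s b) (s c))"
  using Dfn_rename[OF assms, of "\<lambda>n. if n = 0 then a else if n = 1 then b else c"] by simp

text \<open>Induction on \<open>k\<close>: the last two relevant parameters are coded by an ordered
  pair, until only variable \<open>2\<close> remains beside \<open>x\<close> and \<open>y\<close>.
  In \<open>J\<close> the parameter comes first.\<close>

lemma single_parameter_aux:
  assumes M: "transitive M" "models_ZF E M"
  shows "Dfn P \<Longrightarrow> (\<And>D s s'. (\<forall>n<k+3. s n = s' n) \<Longrightarrow> P D s = P D s') \<Longrightarrow> range s \<subseteq> M \<Longrightarrow>
    \<exists>J c. Dfn (\<lambda>D s. J D (s 0) (s 1) (s 2)) \<and> c \<in> M \<and>
      (\<forall>x\<in>M. \<forall>y\<in>M. P M (s(0 := x, 1 := y)) = J M c x y)"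
proof (induction k arbitrary: P s)
  case 0
  define J where "J = (\<lambda>D c x y. P D (\<lambda>n. if n = 0 then x else if n = 1 then y else c))"
  have "Dfn (\<lambda>D s. P D (\<lambda>n. s (if n = 0 then 1 else if n = 1 then 2 else 0)))"
    by (rule Dfn_rename[OF 0(1)])
  also have "(\<lambda>D s. P D (\<lambda>n. s (if n = 0 then 1 else if n = 1 then 2 else 0))) =
      (\<lambda>D s. J D (s 0) (s 1) (s 2))"
    unfolding J_def by (intro ext arg_cong2[where f = P] refl) simp
  finally have "Dfn (\<lambda>D s. J D (s 0) (s 1) (s 2))" .
  moreover have "s 2 \<in> M" using 0(3) by auto
  moreover have "P M (s(0 := x, 1 := y)) = J M (s 2) x y" for x y
    unfolding J_def by (rule 0(2)) (auto simp: less_Suc_eq numeral_3_eq_3 numeral_2_eq_2)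
  ultimately show ?case by blast
next
  case (Suc k)
  \<comment> \<open>\<open>Q\<close> unpacks the pair stored in variable \<open>k + 2\<close>, so
    only variables below \<open>k + 3\<close> stay relevant.\<close>
  define Q where "Q = (\<lambda>D s. \<exists>a\<in>D. \<exists>b\<in>D. pair a b (s (k + 2)) \<and> P D (s(k + 2 := a, k + 3 := b)))"
  have "Dfn (\<lambda>D s. P D (\<lambda>n. s (if n = k + 3 then 0 else if n = k + 2 then Suc 0 else Suc (Suc n))))"
    by (rule Dfn_rename[OF Suc.prems(1)])
  also have "(\<lambda>D s. P D (\<lambda>n. s (if n = k + 3 then 0 else if n = k + 2 then Suc 0 else Suc (Suc n)))) =
     (\<lambda>D s. P D ((\<lambda>n. s (Suc (Suc n)))(k + 2 := s (Suc 0), k + 3 := s 0)))"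
    by (intro ext arg_cong2[where f = P] refl) auto
  finally have "Dfn Q"
    unfolding Q_def by (intro Dfn_ex Dfn_conj Dfn_pair)
  moreover have "Q D s = Q D s'" if eq: "\<forall>n<k+3. s n = s' n" for D s s'
  proof -
    have "P D (s(k + 2 := a, k + 3 := b)) = P D (s'(k + 2 := a, k + 3 := b))" for a b
      by (rule Suc.prems(2)) (use eq in auto)
    then show ?thesis using eq unfolding Q_def by simp
  qed
  moreover
  have in_M: "s (k + 2) \<in> M" "s (k + 3) \<in> M" using Suc.prems(3) by auto
  then obtain p where p: "p \<in> M" "pair (s (k + 2)) (s (k + 3)) p" by (rule pair_exists[OF M])
  have "range (s(k + 2 := p)) \<subseteq> M" using p(1) Suc.prems(3) by auto
  ultimately obtain J c where J: "Dfn (\<lambda>D s. J D (s 0) (s 1) (s 2))" "c \<in> M"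
      "\<forall>x\<in>M. \<forall>y\<in>M. Q M ((s(k + 2 := p))(0 := x, 1 := y)) = J M c x y"
    using Suc.IH[of Q "s(k + 2 := p)"] by blast
  have "Q M ((s(k + 2 := p))(0 := x, 1 := y)) = P M (s(0 := x, 1 := y))" for x y
  proof -
    have eq: "(s(k + 2 := p))(0 := x, 1 := y, k + 2 := s (k + 2), k + 3 := s (k + 3))
        = s(0 := x, 1 := y)" by auto
    have "Q M ((s(k + 2 := p))(0 := x, 1 := y)) \<longleftrightarrow>
        (\<exists>a\<in>M. \<exists>b\<in>M. pair a b p \<and> P M ((s(k + 2 := p))(0 := x, 1 := y, k + 2 := a, k + 3 := b)))"
      unfolding Q_def by simp
    also have "\<dots> \<longleftrightarrow> P M (s(0 := x, 1 := y))"
    proof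
      assume "\<exists>a\<in>M. \<exists>b\<in>M. pair a b p \<and> P M ((s(k + 2 := p))(0 := x, 1 := y, k + 2 := a, k + 3 := b))"
      then obtain a b where "pair a b p"
        and ab: "P M ((s(k + 2 := p))(0 := x, 1 := y, k + 2 := a, k + 3 := b))" by blast
      then have "a = s (k + 2)" "b = s (k + 3)" using pair_inject[OF p(2)] by blast+
      with ab show "P M (s(0 := x, 1 := y))" unfolding eq[symmetric] by blast
    next
      assume "P M (s(0 := x, 1 := y))"
      then show "\<exists>a\<in>M. \<exists>b\<in>M. pair a b p \<and> P M ((s(k + 2 := p))(0 := x, 1 := y, k + 2 := a, k + 3 := b))"
        unfolding eq[symmetric] using in_M p(2) by blast
    qed
    finally show ?thesis .
  qed
  then have "\<forall>x\<in>M. \<forall>y\<in>M. P M (s(0 := x, 1 := y)) = J M c x y" using J(3) by simp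
  with J(1,2) show ?case by blast
qed

lemma single_parameter:
  assumes M: "transitive M" "models_ZF E M" and R: "definable_relation E M R"
  obtains J c where "Dfn (\<lambda>D s. J D (s 0) (s 1) (s 2))" "c \<in> M"
    "\<forall>x\<in>M. \<forall>y\<in>M. (x, y) \<in> R \<longleftrightarrow> J M c x y"
proof -
  obtain p s where p: "range s \<subseteq> M"
      "R = {(x, y). x \<in> M \<and> y \<in> M \<and> sat E M (s(0 := x, 1 := y)) p}"
    using R unfolding definable_relation_def by blast
  obtain k where k: "\<And>D s s'. (\<forall>n<k. s n = s' n) \<Longrightarrow> sat E D s p = sat E D s' p"
    using sat_finite_support[of E p] by blast
  have "Dfn (\<lambda>D s. sat E D s p)" unfolding Dfn_def by blast
  then have "\<exists>J c. Dfn (\<lambda>D s. J D (s 0) (s 1) (s 2)) \<and> c \<in> M \<and>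
      (\<forall>x\<in>M. \<forall>y\<in>M. sat E M (s(0 := x, 1 := y)) p = J M c x y)"
    by (rule single_parameter_aux[OF M, where k = k]) (auto intro!: k p(1))
  then show thesis using that p(2) by auto
qed

text \<open>A counterexample \<open>x\<close> would give the smaller counterexample
  \<open>k x\<close>.\<close>

lemma elem_not_decreasing:
  assumes "elem M N k" "transitive M" "transitive N" "x \<in> M"
  shows "\<not> k x \<epsilon> x"
  using assms(4)
proof (induction x rule: mem_induct)
  case (1 x)
  show ?case
  proof
    assume kx: "k x \<epsilon> x"
    then have "k x \<in> M" using transitiveD[OF assms(2) 1(2)] by blast
    then have "k (k x) \<epsilon> k x" using elem_mem[OF assms(1-3)] kx 1(2) by blast
    then show False using 1(1)[OF kx \<open>k x \<in> M\<close>] by blast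
  qed
qed

lemma elem_ordinal_subset:
  assumes "elem M N k" "transitive M" "transitive N" "x \<in> M" "ordinal E x"
  shows "elts x \<subseteq> elts (k x)"
proof -
  have o: "ordinal E (k x)" using elem_ordinal[OF assms(1-4)] assms(5) by blast
  have "x \<epsilon> k x \<or> x = k x"
    using ordinal_linear[OF assms(5) o] elem_not_decreasing[OF assms(1-4)] by blast
  then show ?thesis using ordinal_trans[OF o] by auto
qed

subsection \<open>Copying a definable embedding along an arbitrary one\<close>

text \<open>\<open>J D c\<close> is the relation defined over \<open>D\<close> from the parameter \<open>c\<close> by a fixed formula.  When it
  is the graph of a map \<open>j\<close>, its target is the union of the sets \<open>j x\<close>.\<close>

definition target :: "('v set \<Rightarrow> 'v \<Rightarrow> 'v \<Rightarrow> 'v \<Rightarrow> bool) \<Rightarrow> 'v set \<Rightarrow> 'v \<Rightarrow> 'v set" where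
  "target J D c = {y \<in> D. \<exists>x\<in>D. \<exists>z\<in>D. J D c x z \<and> y \<epsilon> z}"

text \<open>The invariant of the iteration: \<open>i\<close> is the same function at every stage,
  while \<open>j\<close> is replaced by the map that \<open>J\<close> defines from the next
  parameter.\<close>

definition copy_step ::
    "('v set \<Rightarrow> 'v \<Rightarrow> 'v \<Rightarrow> 'v \<Rightarrow> bool) \<Rightarrow> 'v set \<Rightarrow> 'v set \<Rightarrow> ('v \<Rightarrow> 'v) \<Rightarrow> ('v \<Rightarrow> 'v) \<Rightarrow> 'v \<Rightarrow> bool"
  where
  "copy_step J M N j i c \<longleftrightarrow>
     transitive M \<and> transitive N \<and> elem M N j \<and> elem M N i \<and> c \<in> M \<and> N = target J M c \<and>
     (\<forall>x\<in>M. j x \<in> M \<and> (\<forall>y\<in>M. J M c x y \<longleftrightarrow> y = j x))"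

lemma Dfn_target:
  assumes J: "Dfn (\<lambda>D s. J D (s 0) (s 1) (s 2))"
  shows "Dfn (\<lambda>D s. s a \<in> target J D (s b))"
proof (rule Dfn_cong)
  show "Dfn (\<lambda>D s. \<exists>x\<in>D. \<exists>z\<in>D. J D (s b) x z \<and> s a \<epsilon> z)"
    by (intro Dfn_intros Dfn_reindex3[where J = J, OF J])
qed (auto simp: target_def)

text \<open>Relativization of \<open>p\<close> to the target class, by induction on
  \<open>p\<close>. The renaming \<open>f\<close> is arbitrary because entering a quantifier changes
  it.\<close>

lemma Dfn_sat_target:
  assumes J: "Dfn (\<lambda>D s. J D (s 0) (s 1) (s 2))"
  shows "Dfn (\<lambda>D s. sat E (target J D (s a)) (\<lambda>n. s (f n)) p)"
proof (induction p arbitrary: a f)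
  case (Exists n p)
  have shift: "(\<lambda>m. s (Suc (f m)))(n := s 0) = (\<lambda>m. s (((\<lambda>m. Suc (f m))(n := 0)) m))"
    for s :: "nat \<Rightarrow> 'v" by auto
  have sub: "target J D c \<subseteq> D" for D c by (auto simp: target_def)
  have "Dfn (\<lambda>D s. \<exists>x\<in>D. x \<in> target J D (s a) \<and>
      sat E (target J D (s a)) ((\<lambda>m. s (f m))(n := x)) p)"
    by (intro Dfn_ex Dfn_conj Dfn_target[where J = J, OF J]) (unfold shift, rule Exists)
  then show ?case
    by (rule Dfn_cong[rotated]) (simp, use sub in blast)
qed (simp_all add: Dfn_mem Dfn_eq Dfn_not Dfn_conj)

text \<open>\<open>N\<close> and \<open>j\<close> are defined over \<open>M\<close> from
  \<open>c\<close>, so \<open>i\<close> transfers their properties to the class and the relation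
  defined over \<open>N\<close> from \<open>i c\<close>. Elementarity of \<open>j\<close> is
  transferred one formula at a time.\<close>

lemma copy_step_next:
  assumes J: "Dfn (\<lambda>D s. J D (s 0) (s 1) (s 2))" and step: "copy_step J M N j i c"
  shows "\<exists>k. copy_step J N (target J N (i c)) k i (i c)"
proof -
  let ?T = "target J N (i c)"
  have M: "transitive M" and N: "transitive N" and j: "elem M N j" and i: "elem M N i"
    and c: "c \<in> M" and N_eq: "N = target J M c"
    and J_iff: "\<And>x y. x \<in> M \<Longrightarrow> y \<in> M \<Longrightarrow> J M c x y \<longleftrightarrow> y = j x"
    and j_in: "\<And>x. x \<in> M \<Longrightarrow> j x \<in> M"
    using step unfolding copy_step_def by blast+
  note DJ = Dfn_reindex3[where J = J, OF J] and DT = Dfn_target[where J = J, OF J]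
  have ic: "i c \<in> N" using elem_in[OF i c] .
  have NM: "N \<subseteq> M" unfolding N_eq target_def by blast
  have T_N: "?T \<subseteq> N" unfolding target_def by blast

  define P1 where "P1 = (\<lambda>D c. \<forall>y\<in>D. y \<in> target J D c \<longrightarrow> (\<forall>w\<in>elts y. w \<in> target J D c))"
  have "Dfn (\<lambda>D s. P1 D (s 0))" unfolding P1_def by (intro Dfn_intros DT)
  moreover have "P1 M c" unfolding P1_def N_eq[symmetric] using transitiveD[OF N] by simp
  ultimately have "P1 N (i c)" using elem_Dfn1[OF i M N _ c] by blast
  then have T: "transitive ?T"
    unfolding P1_def transitive_class_def elts_def using T_N by blast

  have i_T: "i y \<in> ?T" if "y \<in> N" for y
    using elem_Dfn2[OF i M N, of "\<lambda>D y c. y \<in> target J D c" y c] DT that NM c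
    unfolding N_eq[symmetric] by blast
  have "sat E N s p \<longleftrightarrow> sat E ?T (i \<circ> s) p" if s: "range s \<subseteq> N" for s p
  proof -
    \<comment> \<open>Truth in \<open>N\<close> is truth in the target over \<open>M\<close>:
      variable \<open>0\<close> holds the parameter and the variables of \<open>p\<close> are
      shifted by \<open>Suc\<close>.\<close>
    have "range (case_nat c s) \<subseteq> M"
      using s NM c by (auto split: nat.splits simp: image_subset_iff)
    from elem_Dfn[OF i M N Dfn_sat_target[where J = J, OF J, of 0 Suc p] this]
    show ?thesis by (simp add: comp_def flip: N_eq)
  qed
  then have i_elem: "elem N ?T i" unfolding elementary_embedding_def using i_T by blast

  define P2 where "P2 = (\<lambda>D c. \<forall>x\<in>D. \<exists>y\<in>D. J D c x y \<and> y \<in> target J D c \<and>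
      (\<forall>z\<in>D. J D c x z \<longrightarrow> z = y))"
  have "Dfn (\<lambda>D s. P2 D (s 0))" unfolding P2_def by (intro Dfn_intros DT DJ)
  moreover have "P2 M c"
    unfolding P2_def N_eq[symmetric] using J_iff j_in elem_in[OF j] by blast
  ultimately have P2: "P2 N (i c)" using elem_Dfn1[OF i M N _ c] by blast
  then have "\<forall>x\<in>N. \<exists>y. y \<in> N \<and> y \<in> ?T \<and> (\<forall>z\<in>N. J N (i c) x z \<longleftrightarrow> z = y)"
    unfolding P2_def by blast
  then have "\<exists>k. \<forall>x\<in>N. k x \<in> N \<and> k x \<in> ?T \<and> (\<forall>z\<in>N. J N (i c) x z \<longleftrightarrow> z = k x)"
    by (rule bchoice)
  then obtain k where k: "\<forall>x\<in>N. k x \<in> N \<and> k x \<in> ?T \<and> (\<forall>z\<in>N. J N (i c) x z \<longleftrightarrow> z = k x)"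
    by blast

  have "sat E N s p \<longleftrightarrow> sat E ?T (k \<circ> s) p" if s: "range s \<subseteq> N" for s p
  proof -
    obtain m where m: "\<And>D s s'. (\<forall>n<m. s n = s' n) \<Longrightarrow> sat E D s p = sat E D s' p"
      using sat_finite_support[of E p] by blast
    \<comment> \<open>\<open>Q\<close> says that the defined map preserves \<open>p\<close>:
      variable \<open>0\<close> holds the parameter, odd variables the arguments, positive even ones
      their values. The bound \<open>m\<close> makes this a single formula.\<close>
    define Q where "Q = (\<lambda>D s. (\<forall>l<m. J D (s 0) (s (Suc (2 * l))) (s (Suc (Suc (2 * l))))) \<longrightarrow>
        (sat E D (\<lambda>l. s (Suc (2 * l))) p \<longleftrightarrow>
          sat E (target J D (s 0)) (\<lambda>l. s (Suc (Suc (2 * l)))) p))"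
    have "Dfn (\<lambda>D s. sat E D s p)" unfolding Dfn_def by blast
    from Dfn_rename[OF this] have Dp: "Dfn (\<lambda>D s. sat E D (\<lambda>n. s (f n)) p)" for f .
    have "Dfn Q"
      unfolding Q_def
      by (intro Dfn_imp Dfn_iff Dfn_all_less DJ Dfn_sat_target[where J = J, OF J] Dp)
    moreover have "Q M e" if e: "range e \<subseteq> M" "e 0 = c" for e
      unfolding Q_def
    proof
      assume *: "\<forall>l<m. J M (e 0) (e (Suc (2 * l))) (e (Suc (Suc (2 * l))))"
      have "e n \<in> M" for n using e(1) by auto
      then have **: "\<forall>l<m. e (Suc (Suc (2 * l))) = j (e (Suc (2 * l)))"
        using * J_iff e(2) by simp
      have "range (\<lambda>l. e (Suc (2 * l))) \<subseteq> M" using e(1) by auto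
      then have "sat E M (\<lambda>l. e (Suc (2 * l))) p \<longleftrightarrow> sat E N (j \<circ> (\<lambda>l. e (Suc (2 * l)))) p"
        using j unfolding elementary_embedding_def by blast
      also have "\<dots> \<longleftrightarrow> sat E N (\<lambda>l. e (Suc (Suc (2 * l)))) p"
        by (rule m) (simp add: **)
      finally show "sat E M (\<lambda>l. e (Suc (2 * l))) p \<longleftrightarrow>
          sat E (target J M (e 0)) (\<lambda>l. e (Suc (Suc (2 * l)))) p"
        unfolding e(2) N_eq[symmetric] .
    qed
    moreover
    \<comment> \<open>\<open>e\<close> interleaves \<open>s\<close> with its image under
      \<open>k\<close>. Its entries need not be values of \<open>i\<close>, hence the use of
      \<open>elem_univ\<close>.\<close>
    define e where "e = (\<lambda>n. if n = 0 then i c else if odd n then s (n div 2) else k (s (n div 2 - 1)))"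
    have s_in: "s n \<in> N" for n using s by auto
    then have "range e \<subseteq> N" unfolding e_def using ic k by auto
    moreover have "e 0 = i c" by (simp add: e_def)
    ultimately have "Q N e" using elem_univ[OF i M N _ c, of Q e] by blast
    moreover have "e (Suc (2 * l)) = s l" "e (Suc (Suc (2 * l))) = k (s l)" for l
      by (simp_all add: e_def)
    ultimately show ?thesis
      unfolding Q_def using \<open>e 0 = i c\<close> k s_in by (simp add: comp_def)
  qed
  then have "elem N ?T k" unfolding elementary_embedding_def using k by blast
  then show ?thesis
    unfolding copy_step_def using N T i_elem ic k by blast
qed

subsection \<open>Collapsing the iteration\<close>

text \<open>Recursion along \<open>G = collapse_step J\<close> gives \<open>r(d) = \<Union>q\<in>Q. ran (j\<^sub>q (r|d))\<close>, where \<open>j\<^sub>q\<close> is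
  the partial map defined by \<open>J\<close> from \<open>q\<close>.\<close>

definition collapse_step ::
    "('v set \<Rightarrow> 'v \<Rightarrow> 'v \<Rightarrow> 'v \<Rightarrow> bool) \<Rightarrow> 'v set \<Rightarrow> 'v \<Rightarrow> 'v \<Rightarrow> 'v \<Rightarrow> bool" where
  "collapse_step J D Q f z \<longleftrightarrow> (\<forall>w\<in>D. w \<epsilon> z \<longleftrightarrow>
     (\<exists>q\<in>elts Q. \<exists>h\<in>D. J D q f h \<and> (\<forall>h'\<in>D. J D q f h' \<longrightarrow> h' = h) \<and> rng w h))"

lemma Dfn_collapse_step:
  assumes J: "Dfn (\<lambda>D s. J D (s 0) (s 1) (s 2))"
  shows "Dfn (\<lambda>D s. collapse_step J D (s a) (s b) (s c))"
  unfolding collapse_step_def by (intro Dfn_intros Dfn_rng Dfn_reindex3[where J = J, OF J])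

text \<open>\<open>A\<close> keeps the q with a unique value at \<open>g\<close>, Replacement
  collects these values in \<open>B\<close>, and a set bounding the range of their union lets
  Separation form the result.\<close>

lemma collapse_step_total:
  assumes J: "Dfn (\<lambda>D s. J D (s 0) (s 1) (s 2))"
    and M: "transitive M" "models_ZF E M" and Q: "Q \<in> M" and g: "g \<in> M"
  shows "\<exists>!z. z \<in> M \<and> collapse_step J M Q g z"
proof -
  note DJ = Dfn_reindex3[where J = J, OF J]
  define V where "V = (\<lambda>D q h g (b :: 'v). J D q g h \<and> (\<forall>h'\<in>D. J D q g h' \<longrightarrow> h' = h))"
  have V: "Dfn (\<lambda>D s. V D (s a) (s b) (s c) (s d))" for a b c d
    unfolding V_def by (intro Dfn_intros DJ)
  define W where "W = (\<lambda>D q g (b :: 'v) (c :: 'v). \<exists>h\<in>D. V D q h g b)"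
  have "Dfn (\<lambda>D s. W D (s 0) (s 1) (s 2) (s 3))" unfolding W_def by (intro Dfn_intros V)
  then obtain A where A: "A \<in> M" "elts A = {q \<in> elts Q. W M q g g g}"
    by (rule separation[where P = W, OF M _ Q g g g])
  have "\<exists>!h. h \<in> M \<and> V M q h g g" if "q \<epsilon> A" for q
    using that A(2) unfolding elts_def W_def V_def by blast
  then obtain B where B: "B \<in> M" "elts B = {h \<in> M. \<exists>q\<in>elts A. V M q h g g}"
    by (rule replacement[where P = V, OF M V A(1) g g])
  obtain u where u: "u \<in> M" "elts u = {z. \<exists>y\<in>elts B. z \<epsilon> y}" by (rule union_exists[OF M B(1)])
  obtain v where v: "v \<in> M" "\<forall>w. rng w u \<longrightarrow> w \<epsilon> v" by (rule rng_in_Union[OF M u(1)])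
  define R where "R = (\<lambda>(D :: 'v set) w B (b :: 'v) (c :: 'v). \<exists>h\<in>elts B. rng w h)"
  have "Dfn (\<lambda>D s. R D (s 0) (s 1) (s 2) (s 3))" unfolding R_def by (intro Dfn_intros Dfn_rng)
  then obtain z where z: "z \<in> M" "elts z = {w \<in> elts v. R M w B g g}"
    by (rule separation[where P = R, OF M _ v(1) B(1) g g])
  have "w \<epsilon> z \<longleftrightarrow> (\<exists>q\<in>elts Q. \<exists>h\<in>M. J M q g h \<and> (\<forall>h'\<in>M. J M q g h' \<longrightarrow> h' = h) \<and> rng w h)"
    for w
  proof -
    have "w \<epsilon> v" if "h \<epsilon> B" "rng w h" for h
      using that v(2) u(2) unfolding rng_def elts_def by blast
    then have "w \<epsilon> z \<longleftrightarrow> (\<exists>h\<in>elts B. rng w h)"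
      using z(2) unfolding R_def elts_def by blast
    also have "\<dots> \<longleftrightarrow> (\<exists>h\<in>M. \<exists>q\<in>elts A. V M q h g g \<and> rng w h)"
      unfolding B(2) by blast
    also have "\<dots> \<longleftrightarrow> (\<exists>q\<in>elts Q. \<exists>h\<in>M. V M q h g g \<and> rng w h)"
      unfolding A(2) W_def by blast
    finally show ?thesis unfolding V_def by simp
  qed
  then have step: "collapse_step J M Q g z" unfolding collapse_step_def by blast
  show ?thesis
  proof (rule ex1I[of _ z])
    show "z \<in> M \<and> collapse_step J M Q g z" using z(1) step by blast
    show "w = z" if "w \<in> M \<and> collapse_step J M Q g w" for w
      using that elts_collect_unique[OF M(1) _ z(1) _ step[unfolded collapse_step_def]]
      unfolding collapse_step_def by blast
  qed
qed

section \<open>Bounds for sets and sequences of ordinals\<close>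

lemma finite_ordinals_bounded:
  assumes M: "transitive M" "models_ZF E M" and ne: "x \<in> ordinal_height E M"
    and fin: "finite F" and sub: "F \<subseteq> ordinal_height E M"
  shows "\<exists>b\<in>ordinal_height E M. \<forall>x\<in>F. x \<epsilon> b"
  using fin sub
proof induction
  case empty
  then show ?case using ne by blast
next
  case (insert y F)
  then obtain b where b: "b \<in> M" "ordinal E b" "\<forall>x\<in>F. x \<epsilon> b"
    unfolding ordinal_height_def by auto
  have y: "y \<in> M" "ordinal E y" using insert.prems unfolding ordinal_height_def by auto
  show ?case
  proof (cases "y \<epsilon> b")
    case True
    then show ?thesis using b unfolding ordinal_height_def by blast
  next
    case False
    obtain u where u: "u \<in> M" "elts u = insert y (elts y)" by (rule succ_exists[OF M y(1)])
    have u_iff: "x \<epsilon> u \<longleftrightarrow> x = y \<or> x \<epsilon> y" for x using u(2) by (metis insert_iff mem_elts)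
    have "b = y \<or> b \<epsilon> y" using ordinal_linear[OF b(2) y(2)] False by blast
    then have "\<forall>x\<in>insert y F. x \<epsilon> u" using b(3) ordinal_trans[OF y(2)] u_iff by blast
    then show ?thesis using u(1) ordinal_succ[OF y(2) u(2)] unfolding ordinal_height_def by blast
  qed
qed

lemma Field_ord_order: "Field (ord_order E \<Omega>) = \<Omega>"
  unfolding ord_order_def Field_def ord_le_def by auto

text \<open>An unbounded \<open>f\<close> would be cofinal from \<open>natLeq\<close>, and no
  smaller well-order admits a cofinal map, since the image of a finite one is bounded. The
  cofinality would then be \<omega>.\<close>

lemma countable_ordinals_bounded:
  fixes f :: "nat \<Rightarrow> 'v"
  assumes M: "transitive M" "models_ZF E M" and \<Omega>: "\<Omega> = ordinal_height E M"
    and cof: "\<not> has_cofinality (ord_order E \<Omega>) natLeq" and f: "\<And>n. f n \<in> \<Omega>"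
  shows "\<exists>b\<in>\<Omega>. \<forall>n. f n \<epsilon> b"
proof (rule ccontr)
  assume unb: "\<not> ?thesis"
  have ord: "ordinal E x" if "x \<in> \<Omega>" for x using that unfolding \<Omega> ordinal_height_def by blast
  have "\<exists>n. (b, f n) \<in> ord_order E \<Omega>" if b: "b \<in> \<Omega>" for b
  proof -
    obtain n where "\<not> f n \<epsilon> b" using unb b by blast
    then show ?thesis
      using ordinal_linear[OF ord[OF b] ord[OF f]] b f unfolding ord_order_def ord_le_def by blast
  qed
  then have "cofinal_map natLeq (ord_order E \<Omega>) f"
    unfolding cofinal_map_def Field_ord_order Field_natLeq using f by blast
  moreover have "(natLeq, s) \<in> ordLeq" if s: "Well_order s" and g: "cofinal_map s (ord_order E \<Omega>) g"
    for s :: "nat rel" and g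
  proof -
    have "infinite (Field s)"
    proof
      assume "finite (Field s)"
      moreover have "g ` Field s \<subseteq> \<Omega>" using g unfolding cofinal_map_def Field_ord_order by blast
      ultimately obtain b where b: "b \<in> \<Omega>" "\<forall>x\<in>g ` Field s. x \<epsilon> b"
        using finite_ordinals_bounded[OF M f[of 0, unfolded \<Omega>], of "g ` Field s"] unfolding \<Omega>
        by blast
      then obtain n where "n \<in> Field s" "(b, g n) \<in> ord_order E \<Omega>"
        using g unfolding cofinal_map_def Field_ord_order by blast
      then have "ord_le E b (g n)" "g n \<epsilon> b" using b(2) unfolding ord_order_def by auto
      then show False unfolding ord_le_def using mem_asym mem_irrefl by blast
    qed
    then have "(natLeq, card_of (Field s)) \<in> ordLeq" using infinite_iff_natLeq_ordLeq by blast
    then show ?thesis using card_of_least[OF s] ordLeq_transitive by blast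
  qed
  ultimately show False
    using cof natLeq_Well_order unfolding has_cofinality_def by blast
qed

text \<open>An element of \<open>N\<close> of rank at most \<open>t\<close> lies in the level of
  \<open>N\<close> at \<open>j t\<close>, as \<open>t\<close> is at most \<open>j t\<close>. That
  level is \<open>j v\<close> for the level \<open>v\<close> of \<open>M\<close> at
  \<open>t\<close>, where \<open>height\<close> supplies \<open>t\<close> in
  \<open>M\<close>.\<close>

lemma target_eq:
  assumes M: "transitive M" "models_ZF E M" and N: "transitive N" "models_ZF E N"
    and j: "elem M N j" and height: "ordinal_height E N \<subseteq> M"
    and J: "\<And>x y. x \<in> M \<Longrightarrow> y \<in> M \<Longrightarrow> J M c x y \<longleftrightarrow> y = j x" and j_in: "\<And>x. x \<in> M \<Longrightarrow> j x \<in> M"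
  shows "N = target J M c"
proof
  show "target J M c \<subseteq> N"
    unfolding target_def using J transitiveD[OF N(1) elem_in[OF j]] by blast
  show "N \<subseteq> target J M c"
  proof
    fix y assume y: "y \<in> N"
    obtain t where t: "t \<in> N" "ordinal E t" "rank_le y t" using rank_exists[OF N y] by blast
    have tM: "t \<in> M" using t height unfolding ordinal_height_def by blast
    obtain v where v: "v \<in> M" "level M t v" by (rule level_exists[OF M tM t(2)])
    have "level N (j t) (j v)"
      using elem_Dfn2[OF j M(1) N(1), of "\<lambda>D t v. level D t v"] Dfn_level tM v by blast
    moreover have "ordinal E (j t)" using elem_ordinal[OF j M(1) N(1) tM] t(2) by blast
    ultimately have "elts (j v) = {x \<in> N. rank_le x (j t)}"
      using level_elts[OF N(1)] elem_in[OF j v(1)] by blast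
    moreover have "rank_le y (j t)"
      using rank_le_mono[OF t(3) elem_ordinal_subset[OF j M(1) N(1) tM t(2)]] .
    ultimately have "y \<epsilon> j v" using y unfolding elts_def by blast
    then show "y \<in> target J M c"
      unfolding target_def using J[OF v(1) j_in[OF v(1)]] v(1) j_in[OF v(1)]
        transitiveD[OF M(1) j_in[OF v(1)]] by blast
  qed
qed

text \<open>The iterates of the two embeddings: \<open>N n\<close> is the \<open>n\<close>-th model, \<open>k n : N n \<rightarrow> N (n + 1)\<close> is the
  copy of \<open>j\<close> defined from \<open>c n = i\<^sup>n c\<close>, and \<open>a n = i\<^sup>n \<alpha>\<close>.\<close>

lemma no_descending_thread:
  fixes N :: "nat \<Rightarrow> 'v set" and k :: "nat \<Rightarrow> 'v \<Rightarrow> 'v"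
  assumes J: "Dfn (\<lambda>D s. J D (s 0) (s 1) (s 2))"
    and ZF: "models_ZF E (N 0)"
    and step: "\<And>n. copy_step J (N n) (N (Suc n)) (k n) i (c n)"
    and bound: "\<gamma> \<in> N 0" "ordinal E \<gamma>" "\<And>n. rank_le (c n) \<gamma>"
    and a: "a 0 \<in> N 0" "ordinal E (a 0)" "\<And>n. a (Suc n) \<epsilon> k n (a n)"
  shows False
proof -
  note DJ = Dfn_reindex3[where J = J, OF J]
  have tr: "transitive (N n)" and k: "elem (N n) (N (Suc n)) (k n)"
    and c: "c n \<in> N n" and sub: "N (Suc n) \<subseteq> N n"
    and k_iff: "\<And>x y. x \<in> N n \<Longrightarrow> y \<in> N n \<Longrightarrow> J (N n) (c n) x y \<longleftrightarrow> y = k n x"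
    for n
    using step[of n] unfolding copy_step_def target_def by blast+
  \<comment> \<open>\<open>it x n\<close> is the image of \<open>x\<close> under the first
    \<open>n\<close> of the maps \<open>k\<close>; the sequences \<open>c\<close> and
    \<open>a\<close> are not moved by these maps.\<close>
  define it where "it = (\<lambda>x. rec_nat x k)"
  have it_0: "it x 0 = x" and it_Suc: "it x (Suc n) = k n (it x n)" for x n
    by (simp_all add: it_def)
  have it_in: "it x n \<in> N n" if "x \<in> N 0" for x n
    by (induction n) (use that elem_in[OF k] in \<open>simp_all add: it_0 it_Suc\<close>)
  have it_ord: "ordinal E (it x n)" if x: "x \<in> N 0" "ordinal E x" for x n
    by (induction n)
      (use x elem_ordinal[OF k tr tr it_in[OF x(1)]] in \<open>simp_all add: it_0 it_Suc\<close>)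

  obtain Q where Q: "Q \<in> N 0" "level (N 0) \<gamma> Q" by (rule level_exists[OF tr ZF bound(1,2)])
  \<comment> \<open>The domain is the successor of \<open>a 0\<close>, so that \<open>r\<close> is
    defined at \<open>a 0\<close> itself.\<close>
  obtain t where t: "t \<in> N 0" "elts t = insert (a 0) (elts (a 0))"
    by (rule succ_exists[OF tr ZF a(1)])
  have t_ord: "ordinal E t" using ordinal_succ[OF a(2) t(2)] .
  note DC = Dfn_collapse_step[where J = J, OF J]
  obtain r where r: "r \<in> N 0" "approx (collapse_step J) (N 0) Q t r"
    using approx_exists[where G = "collapse_step J", OF tr ZF DC Q(1)
        collapse_step_total[where J = J, OF J tr ZF Q(1)] t(1) t_ord] by blast

  have Q_n: "level (N n) (it \<gamma> n) (it Q n)" for n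
  proof (induction n)
    case (Suc n)
    then show ?case
      using elem_Dfn2[OF k tr tr, of "\<lambda>D t v. level D t v"] Dfn_level it_in bound(1) Q(1)
      unfolding it_Suc by blast
  qed (simp add: it_0 Q)
  have r_n: "approx (collapse_step J) (N n) (it Q n) (it t n) (it r n)" for n
  proof (induction n)
    case (Suc n)
    then show ?case
      using elem_Dfn3[OF k tr tr, of "\<lambda>D x y z. approx (collapse_step J) D x y z"]
        Dfn_approx[where G = "collapse_step J", OF DC] it_in Q(1) t(1) r(1)
      unfolding it_Suc by blast
  qed (simp add: it_0 r)
  have \<gamma>_n: "elts \<gamma> \<subseteq> elts (it \<gamma> n)" for n
  proof (induction n)
    case (Suc n)
    then show ?case
      using elem_ordinal_subset[OF k tr tr it_in[OF bound(1)] it_ord[OF bound(1,2)]]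
      unfolding it_Suc by blast
  qed (simp add: it_0)
  \<comment> \<open>\<open>it Q n\<close> is the level of \<open>N n\<close> at
    \<open>it \<gamma> n\<close>, which includes \<open>\<gamma>\<close>. Hence \<open>c n\<close>
    is among the parameters used by the recursion at stage \<open>n\<close>.\<close>
  have c_n: "c n \<epsilon> it Q n" for n
    using level_elts[OF tr it_ord[OF bound(1,2)] it_in[OF Q(1)] Q_n] c
      rank_le_mono[OF bound(3) \<gamma>_n] unfolding elts_def by blast
  have a_n: "a n \<epsilon> it t n" for n
  proof (induction n)
    case 0
    then show ?case using t(2) unfolding it_0 elts_def by blast
  next
    case (Suc n)
    then have "k n (a n) \<epsilon> it t (Suc n)"
      using elem_mem[OF k tr tr _ it_in[OF t(1)]] transitiveD[OF tr it_in[OF t(1)]]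
      unfolding it_Suc by blast
    then show ?case using a(3) ordinal_trans[OF it_ord[OF t(1) t_ord]] by blast
  qed
  have "\<exists>v. fapp (it r n) (a n) v" for n
    by (rule approxD[OF r_n a_n[of n]]) blast
  then obtain v where v: "fapp (it r n) (a n) (v n)" for n by metis

  \<comment> \<open>\<open>k n g\<close> is the restriction of \<open>it r (Suc n)\<close> to
    \<open>k n (a n)\<close>, so \<open>v (Suc n)\<close> is in its range. Since \<open>J\<close>
    defines \<open>k n\<close> from \<open>c n\<close>, the recursion puts that range into
    \<open>v n\<close>.\<close>
  have "v (Suc n) \<epsilon> v n" for n
  proof -
    obtain g z where g: "g \<in> N n" "restr (it r n) (a n) g" "z \<in> N n"
      "collapse_step J (N n) (it Q n) g z" "fapp (it r n) (a n) z"
      by (rule approxD[OF r_n a_n])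
    have z: "z = v n" using approx_fapp_unique[OF r_n g(5) v] .
    have an: "a n \<in> N n" using transitiveD[OF tr it_in[OF t(1)] a_n] .
    have kg: "k n g \<in> N n" using elem_in[OF k g(1)] sub by blast
    have "restr (it r (Suc n)) (k n (a n)) (k n g)"
      using elem_Dfn3[OF k tr tr, of "\<lambda>D x y z. restr x y z"] Dfn_restr g(1,2) an it_in[OF r(1)]
      unfolding it_Suc by blast
    then have "fapp (k n g) (a (Suc n)) (v (Suc n))" using fapp_restr a(3) v by blast
    then have "rng (v (Suc n)) (k n g)" unfolding rng_iff by blast
    moreover have "v (Suc n) \<in> N n" using fapp_in[OF tr it_in[OF r(1)] v] sub by blast
    ultimately show ?thesis
      using g(4) k_iff[OF g(1)] kg c_n[of n] unfolding collapse_step_def z elts_def by blast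
  qed
  then show False using no_descending by blast
qed

end

section \<open>Iterating both embeddings and reaching the contradiction\<close>

theorem theorem6p15:
  fixes E :: "'v \<Rightarrow> 'v \<Rightarrow> bool"
    and M N \<Omega> :: "'v set"
    and i j :: "'v \<Rightarrow> 'v"
  assumes "set_universe E"
    and "transitive_class E M" and "models_ZF E M" and "models_DC E M"
    and "transitive_class E N" and "models_ZF E N" and "models_DC E N"
    and "ordinal_height E M = \<Omega>" and "ordinal_height E N = \<Omega>"
    and "\<not> has_cofinality (ord_order E \<Omega>) natLeq"
    and "elementary_embedding E M N j" and "definable_map E M j"
    and "elementary_embedding E M N i"
  shows "\<forall>\<alpha>\<in>\<Omega>. ord_le E (j \<alpha>) (i \<alpha>)"
proof (rule ballI, rule ccontr)
  fix \<alpha> assume \<alpha>: "\<alpha> \<in> \<Omega>" and neg: "\<not> ord_le E (j \<alpha>) (i \<alpha>)"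
  interpret set_univ E by unfold_locales (rule assms(1))
  note M = assms(2,3) and N = assms(5,6) and j = assms(11) and i = assms(13)
  have \<Omega>: "\<Omega> = ordinal_height E M" "\<Omega> = ordinal_height E N" using assms(8,9) by simp_all
  have \<alpha>M: "\<alpha> \<in> M" "ordinal E \<alpha>" using \<alpha> unfolding \<Omega>(1) ordinal_height_def by auto
  have ij: "E (i \<alpha>) (j \<alpha>)"
    using ordinal_linear[of "j \<alpha>" "i \<alpha>"] elem_ordinal[OF j M(1) N(1) \<alpha>M(1)]
      elem_ordinal[OF i M(1) N(1) \<alpha>M(1)] \<alpha>M(2) neg unfolding ord_le_def by blast

  have def_j: "definable_relation E M {(x, j x) |x. x \<in> M}"
    using assms(12) unfolding definable_map_def .
  then have j_in: "j x \<in> M" if "x \<in> M" for x using that unfolding definable_relation_def by blast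
  obtain J c where J: "Dfn (\<lambda>D s. J D (s 0) (s 1) (s 2))" and c: "c \<in> M"
    and graph: "\<forall>x\<in>M. \<forall>y\<in>M. (x, y) \<in> {(x, j x) |x. x \<in> M} \<longleftrightarrow> J M c x y"
    by (rule single_parameter[OF M def_j])
  have J_iff: "J M c x y \<longleftrightarrow> y = j x" if "x \<in> M" "y \<in> M" for x y using graph that by blast
  have N_eq: "N = target J M c"
    by (rule target_eq[OF M N j]) (use \<Omega> J_iff j_in in \<open>auto simp: ordinal_height_def\<close>)
  have step_0: "copy_step J M N j i c"
    unfolding copy_step_def using M(1) N(1) j i c N_eq J_iff j_in by blast

  define cs where "cs n = (i ^^ n) c" for n
  define al where "al n = (i ^^ n) \<alpha>" for n
  define Ns where "Ns = rec_nat M (\<lambda>n D. target J D (cs n))"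
  have Ns: "Ns 0 = M" "Ns (Suc n) = target J (Ns n) (cs n)" for n by (simp_all add: Ns_def)
  have "\<exists>k. copy_step J (Ns n) (Ns (Suc n)) k i (cs n)" for n
  proof (induction n)
    case 0
    show ?case using step_0 by (auto simp: Ns cs_def simp flip: N_eq)
  next
    case (Suc n)
    then obtain k where "copy_step J (Ns n) (Ns (Suc n)) k i (cs n)" by blast
    from copy_step_next[OF J this] show ?case by (simp add: Ns(2)[of "Suc n"] cs_def)
  qed
  then obtain k where step: "\<And>n. copy_step J (Ns n) (Ns (Suc n)) (k n) i (cs n)" by metis
  have tr: "transitive_class E (Ns n)" and in_n: "elementary_embedding E (Ns n) (Ns (Suc n)) i" and cs: "cs n \<in> Ns n"
    and sub: "Ns (Suc n) \<subseteq> Ns n"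
    and k: "\<And>x y. x \<in> Ns n \<Longrightarrow> y \<in> Ns n \<Longrightarrow> J (Ns n) (cs n) x y \<longleftrightarrow> y = k n x"
    for n
    using step[of n] unfolding copy_step_def target_def by blast+
  have al: "al n \<in> Ns n" for n
  proof (induction n)
    case 0
    show ?case using \<alpha>M(1) by (simp add: al_def Ns)
  next
    case (Suc n)
    then show ?case using elem_in[OF in_n] by (simp add: al_def)
  qed
  define P where "P = (\<lambda>D c a b. \<exists>z\<in>D. J D c a z \<and> E b z)"
  have P: "Dfn (\<lambda>D s. P D (s 0) (s 1) (s 2))"
    unfolding P_def by (intro Dfn_intros Dfn_reindex3[where J = J, OF J])
  have "P (Ns n) (cs n) (al n) (al (Suc n))" for n
  proof (induction n)
    case 0
    show ?case
      using ij J_iff[OF \<alpha>M(1)] j_in[OF \<alpha>M(1)] by (auto simp: P_def Ns cs_def al_def)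
  next
    case (Suc n)
    have "al (Suc n) \<in> Ns n" using al[of "Suc n"] sub by blast
    then have "P (Ns (Suc n)) (i (cs n)) (i (al n)) (i (al (Suc n)))"
      using elem_Dfn3[OF in_n tr tr P cs al] Suc by blast
    then show ?case by (simp add: cs_def al_def)
  qed
  then have desc: "E (al (Suc n)) (k n (al n))" for n
    using k[OF al] unfolding P_def by blast

  have "cs n \<in> M" for n
  proof -
    have "Ns n \<subseteq> M" by (induction n) (use sub Ns(1) in auto)
    then show ?thesis using cs by blast
  qed
  then have "\<forall>n. \<exists>t. t \<in> \<Omega> \<and> rank_le (cs n) t"
    using rank_exists[OF M] unfolding \<Omega>(1) ordinal_height_def by blast
  then obtain f where f: "\<And>n. f n \<in> \<Omega>" "\<And>n. rank_le (cs n) (f n)" by metis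
  \<comment> \<open>The sequence \<open>cs\<close> arises outside \<open>M\<close>, so Replacement
    in \<open>M\<close> need not bound its ranks; the cofinality hypothesis does.\<close>
  obtain \<gamma> where \<gamma>: "\<gamma> \<in> \<Omega>" "\<forall>n. E (f n) \<gamma>"
    using countable_ordinals_bounded[where f = f, OF M \<Omega>(1) assms(10) f(1)] by blast
  have \<gamma>M: "\<gamma> \<in> M" "ordinal E \<gamma>" using \<gamma>(1) unfolding \<Omega>(1) ordinal_height_def by auto
  have "elts (f n) \<subseteq> elts \<gamma>" for n
    using \<gamma>(2) ordinal_trans[OF \<gamma>M(2)] unfolding elts_def by blast
  then have "rank_le (cs n) \<gamma>" for n using rank_le_mono[OF f(2)] by blast
  then show False
    using no_descending_thread[where N = Ns and k = k and c = cs and a = al and \<gamma> = \<gamma>,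
        OF J _ step] M(2) \<gamma>M \<alpha>M desc
    by (auto simp: Ns al_def)
qed

end
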